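(* Let $\mathbb{F}$ be any field. For all integers $n>1000$ and all real $\alpha\in(0,0.1)$, there is an $n\times n$ tropical matrix $A$ (with entries in $\overline{\mathbb{R}}=\mathbb{R}\cup\{\infty\}$) such that $$\operatorname{tropical\ rank}(A)\leqslant\frac{4\sqrt{n}\ln n}{\alpha^2}\quad\text{and}\quad \operatorname{Kapranov\ rank}(A)\geqslant n(1-\alpha),$$ where the Kapranov rank is taken over $\mathbb{F}$.
   Context: Tropical semiring: $\overline{\mathbb{R}}=\mathbb{R}\cup\{\infty\}$ with tropical addition $\min$ and tropical multiplication $+$. For a square tropical matrix $B$ of size $m$, say $B$ is tropically non-singular if the minimum $\min_{\sigma\in S_m}\sum_{p=1}^m B(p|\sigma(p))$ is finite and attained by exactly one permutation $\sigma$; otherwise it is tropically singular. The tropical rank of a tropical matrix is the largest size of a tropically non-singular square submatrix. Let $\mathcal{F}=\mathbb{F}\{\{t\}\}$ be the field of generalized Puiseux series: formal sums $\sum_{e\in\mathbb{R}}a_et^e$ with $a_e\in\mathbb{F}$ whose support $\{e:a_e\neq 0\}$ is well-ordered; define $\deg a=\min\operatorname{Supp}(a)$ and $\deg 0=\infty$. The Kapranov rank (over $\mathbb{F}$) of a tropical matrix $A$ is the smallest rank of a matrix $L$ with entries in $\mathcal{F}$ such that $\deg L(p|q)=A(p|q)$ for all entries. *)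

theory Defs
  imports
    Complex_Main
    "HOL-Library.Extended_Real"
    "Jordan_Normal_Form.DL_Rank"
    "Jordan_Normal_Form.DL_Submatrix"
begin

section \<open>Well-ordered sets of reals\<close>

definition well_ordered :: "real set \<Rightarrow> bool" where
  "well_ordered S \<longleftrightarrow> (\<forall>T\<subseteq>S. T \<noteq> {} \<longrightarrow> (\<exists>m\<in>T. \<forall>x\<in>T. m \<le> x))"

lemma well_ordered_least:
  "well_ordered S \<Longrightarrow> T \<subseteq> S \<Longrightarrow> T \<noteq> {} \<Longrightarrow> \<exists>m\<in>T. \<forall>x\<in>T. m \<le> x"
  unfolding well_ordered_def by blast

lemma well_ordered_subset: "well_ordered S \<Longrightarrow> T \<subseteq> S \<Longrightarrow> well_ordered T"
  unfolding well_ordered_def by blast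

lemma well_ordered_empty [simp]: "well_ordered {}"
  unfolding well_ordered_def by blast

lemma well_ordered_Un:
  assumes "well_ordered S" "well_ordered T"
  shows "well_ordered (S \<union> T)"
  unfolding well_ordered_def
proof (intro allI impI)
  fix U assume U: "U \<subseteq> S \<union> T" "U \<noteq> {}"
  show "\<exists>m\<in>U. \<forall>x\<in>U. m \<le> x"
  proof (cases "U \<inter> S = {} \<or> U \<inter> T = {}")
    case True
    then have "U \<subseteq> S \<or> U \<subseteq> T" using U by blast
    then show ?thesis using assms U unfolding well_ordered_def by blast
  next
    case False
    obtain m where m: "m \<in> U \<inter> S" "\<And>x. x \<in> U \<inter> S \<Longrightarrow> m \<le> x"
      using well_ordered_least[OF assms(1), of "U \<inter> S"] False by blast
    obtain k where k: "k \<in> U \<inter> T" "\<And>x. x \<in> U \<inter> T \<Longrightarrow> k \<le> x"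
      using well_ordered_least[OF assms(2), of "U \<inter> T"] False by blast
    have "min m k \<in> U" using m k by (auto simp: min_def)
    moreover have "min m k \<le> x" if "x \<in> U" for x
      using that U(1) m(2)[of x] k(2)[of x] by (auto simp: min_le_iff_disj)
    ultimately show ?thesis by blast
  qed
qed

lemma well_ordered_singleton [simp]: "well_ordered {x}"
  unfolding well_ordered_def by auto

lemma well_ordered_no_descent:
  assumes "well_ordered S" "range f \<subseteq> S"
  shows "\<not> (\<forall>n::nat. f (Suc n) < f n)"
proof
  assume dec: "\<forall>n. f (Suc n) < f n"
  obtain m where m: "m \<in> range f" "\<And>x. x \<in> range f \<Longrightarrow> m \<le> x"
    using well_ordered_least[OF assms] by blast
  then obtain n where "m = f n" by blast
  then have "f n \<le> f (Suc n)" using m(2) by blast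
  then show False using dec leD by blast
qed

lemma well_ordered_incseq_sub:
  fixes f :: "nat \<Rightarrow> real"
  assumes "well_ordered S" "range f \<subseteq> S"
  obtains g :: "nat \<Rightarrow> nat" where "strict_mono g" "\<And>m n. m \<le> n \<Longrightarrow> f (g m) \<le> f (g n)"
proof -
  obtain h where h: "strict_mono h" "monoseq (\<lambda>n. f (h n))"
    using seq_monosub by blast
  from h(2) consider "\<forall>m. \<forall>n\<ge>m. f (h m) \<le> f (h n)" | "\<forall>m. \<forall>n\<ge>m. f (h n) \<le> f (h m)"
    unfolding monoseq_def by blast
  then show ?thesis
  proof cases
    case 1
    then show ?thesis using that h(1) by blast
  next
    case 2
    have "range (\<lambda>n. f (h n)) \<subseteq> S" using assms(2) by blast
    from well_ordered_least[OF assms(1) this] obtain m where m: "m \<in> range (\<lambda>n. f (h n))"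
      "\<And>x. x \<in> range (\<lambda>n. f (h n)) \<Longrightarrow> m \<le> x"
      by blast
    then obtain N where N: "m = f (h N)" by blast
    have eq: "f (h (n + N)) = m" for n
      using 2 m(2)[of "f (h (n + N))"] N by (simp add: antisym)
    have "strict_mono (\<lambda>n. h (n + N))"
      using h(1) by (simp add: strict_mono_def)
    then show ?thesis using that[of "\<lambda>n. h (n + N)"] eq by simp
  qed
qed

lemma well_ordered_plus:
  assumes S: "well_ordered S" and T: "well_ordered T"
  shows "well_ordered {x + y |x y. x \<in> S \<and> y \<in> T}"
proof (rule ccontr)
  assume "\<not> ?thesis"
  then obtain U where U: "U \<subseteq> {x + y |x y. x \<in> S \<and> y \<in> T}" "U \<noteq> {}"
    "\<And>m. m \<in> U \<Longrightarrow> \<exists>x\<in>U. x < m"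
    unfolding well_ordered_def by (auto simp: not_le)
  have "\<exists>f. \<forall>n::nat. f n \<in> U \<and> f (Suc n) < f n"
  proof (rule dependent_nat_choice[where P = "\<lambda>_ x. x \<in> U" and Q = "\<lambda>_ x y. y < x"])
    show "\<exists>x. x \<in> U" using U(2) by blast
    show "\<exists>y. y \<in> U \<and> y < x" if "x \<in> U" for x using U(3)[OF that] by blast
  qed
  then obtain f where f: "\<And>n::nat. f n \<in> U" "\<And>n. f (Suc n) < f n" by blast
  have "\<forall>n. \<exists>x y. x \<in> S \<and> y \<in> T \<and> f n = x + y" using f(1) U(1) by blast
  then obtain a b where ab: "\<And>n. a n \<in> S" "\<And>n. b n \<in> T" "\<And>n. f n = a n + b n" by metis
  obtain g :: "nat \<Rightarrow> nat" where g: "strict_mono g" "\<And>m n. m \<le> n \<Longrightarrow> a (g m) \<le> a (g n)"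
    using well_ordered_incseq_sub[OF S, of a] ab(1) by blast
  have fdec: "f n < f m" if "m < n" for m n
    using lift_Suc_mono_less[of "\<lambda>n. - f n" m n] f(2) that by simp
  have "\<forall>n. b (g (Suc n)) < b (g n)"
  proof
    fix n
    have "f (g (Suc n)) < f (g n)" using fdec g(1) by (simp add: strict_mono_def)
    moreover have "a (g n) \<le> a (g (Suc n))" using g(2) by simp
    ultimately show "b (g (Suc n)) < b (g n)" using ab(3) by (smt (verit))
  qed
  then show False using well_ordered_no_descent[OF T, of "\<lambda>n. b (g n)"] ab(2) by blast
qed

lemma well_ordered_finite_decomp:
  assumes S: "well_ordered S" and T: "well_ordered T"
  shows "finite {x. x \<in> S \<and> e - x \<in> T}"
proof -
  define X where "X = {x. x \<in> S \<and> e - x \<in> T}"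
  have max: "\<exists>m\<in>Y. \<forall>x\<in>Y. x \<le> m" if Y: "Y \<subseteq> X" "Y \<noteq> {}" for Y
  proof -
    have "(\<lambda>x. e - x) ` Y \<subseteq> T" using Y X_def by blast
    then obtain m where m: "m \<in> (\<lambda>x. e - x) ` Y" "\<And>x. x \<in> (\<lambda>x. e - x) ` Y \<Longrightarrow> m \<le> x"
      using well_ordered_least[OF T, of "(\<lambda>x. e - x) ` Y"] Y(2) by blast
    then obtain k where k: "k \<in> Y" "m = e - k" by blast
    have "x \<le> k" if "x \<in> Y" for x using m(2)[of "e - x"] k(2) that by simp
    then show ?thesis using k(1) by blast
  qed
  have fin: "finite {y \<in> X. y \<le> x}" if "x \<in> X" for x
  proof (rule ccontr)
    assume "\<not> ?thesis"
    then have ne: "{x \<in> X. infinite {y \<in> X. y \<le> x}} \<noteq> {}" using that by blast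
    have "{x \<in> X. infinite {y \<in> X. y \<le> x}} \<subseteq> S" using X_def by blast
    from well_ordered_least[OF S this ne] obtain m where m: "m \<in> {x \<in> X. infinite {y \<in> X. y \<le> x}}"
      "\<And>z. z \<in> {x \<in> X. infinite {y \<in> X. y \<le> x}} \<Longrightarrow> m \<le> z"
      by blast
    have split: "{y \<in> X. y \<le> m} = insert m {y \<in> X. y < m}" using m(1) by auto
    then have inf: "infinite {y \<in> X. y < m}" using m(1) by auto
    then have "{y \<in> X. y < m} \<noteq> {}" by (metis finite.emptyI)
    then obtain k where k: "k \<in> {y \<in> X. y < m}" "\<forall>x\<in>{y \<in> X. y < m}. x \<le> k"
      using max[of "{y \<in> X. y < m}"] by blast
    then have "{y \<in> X. y < m} \<subseteq> {y \<in> X. y \<le> k}" by blast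
    then have "infinite {y \<in> X. y \<le> k}" using inf finite_subset by blast
    then show False using m(2)[of k] k(1) by auto
  qed
  have "finite X"
  proof (cases "X = {}")
    case False
    then obtain m where "m \<in> X" "\<forall>x\<in>X. x \<le> m" using max[of X] by blast
    then have "X = {y \<in> X. y \<le> m}" by blast
    then show ?thesis using fin[OF \<open>m \<in> X\<close>] by simp
  qed simp
  then show ?thesis unfolding X_def .
qed

section \<open>Generalized Puiseux series\<close>

typedef (overloaded) 'a gpuiseux = "{f :: real \<Rightarrow> 'a::zero. well_ordered {e. f e \<noteq> 0}}"
  morphisms gp_coeff Abs_gpuiseux
  by (rule exI[of _ "\<lambda>_. 0"]) simp

setup_lifting type_definition_gpuiseux

definition gp_supp :: "'a::zero gpuiseux \<Rightarrow> real set" where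
  "gp_supp a = {e. gp_coeff a e \<noteq> 0}"

lemma well_ordered_gp_supp: "well_ordered (gp_supp a)"
  using gp_coeff[of a] by (simp add: gp_supp_def)

lemma gp_eqI: "(\<And>e. gp_coeff a e = gp_coeff b e) \<Longrightarrow> a = b"
  by (metis ext gp_coeff_inject)

lemma gp_coeff_Abs: "well_ordered {e. f e \<noteq> 0} \<Longrightarrow> gp_coeff (Abs_gpuiseux f) = f"
  by (simp add: Abs_gpuiseux_inverse)

instantiation gpuiseux :: (zero) zero
begin
lift_definition zero_gpuiseux :: "'a gpuiseux" is "\<lambda>_. 0" by simp
instance ..
end

instantiation gpuiseux :: ("{zero, one}") one
begin
lift_definition one_gpuiseux :: "'a gpuiseux" is "\<lambda>e. if e = 0 then 1 else 0"
  by (rule well_ordered_subset[of "{0}"]) auto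
instance ..
end

lemma well_ordered_supp_add:
  fixes f g :: "real \<Rightarrow> 'a::comm_monoid_add"
  assumes "well_ordered {e. f e \<noteq> 0}" "well_ordered {e. g e \<noteq> 0}"
  shows "well_ordered {e. f e + g e \<noteq> 0}"
  by (rule well_ordered_subset[OF well_ordered_Un[OF assms]]) auto

instantiation gpuiseux :: (comm_monoid_add) comm_monoid_add
begin
lift_definition plus_gpuiseux :: "'a gpuiseux \<Rightarrow> 'a gpuiseux \<Rightarrow> 'a gpuiseux"
  is "\<lambda>f g e. f e + g e" by (rule well_ordered_supp_add)
instance by standard (transfer; simp add: ac_simps fun_eq_iff)+
end

instantiation gpuiseux :: (ab_group_add) ab_group_add
begin
lift_definition uminus_gpuiseux :: "'a gpuiseux \<Rightarrow> 'a gpuiseux"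
  is "\<lambda>f e. - f e" by simp
lift_definition minus_gpuiseux :: "'a gpuiseux \<Rightarrow> 'a gpuiseux \<Rightarrow> 'a gpuiseux"
  is "\<lambda>f g e. f e - g e"
  subgoal for f g using well_ordered_supp_add[of f "\<lambda>e. - g e"] by simp
  done
instance by standard (transfer; simp)+
end

lemma gp_coeff_zero [simp]: "gp_coeff 0 e = 0" by transfer simp
lemma gp_coeff_one: "gp_coeff 1 e = (if e = 0 then 1 else 0)" by transfer simp
lemma gp_coeff_plus [simp]: "gp_coeff (a + b) e = gp_coeff a e + gp_coeff b e"
  by transfer simp
lemma gp_coeff_uminus [simp]: "gp_coeff (- a) e = - gp_coeff a e" by transfer simp
lemma gp_coeff_minus [simp]: "gp_coeff (a - b) e = gp_coeff a e - gp_coeff b e"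
  by transfer simp
lemma gp_coeff_sum: "gp_coeff (sum f A) e = (\<Sum>x\<in>A. gp_coeff (f x) e)"
  by (induction A rule: infinite_finite_induct) auto

definition gp_conv :: "(real \<Rightarrow> 'a::comm_ring_1) \<Rightarrow> (real \<Rightarrow> 'a) \<Rightarrow> real \<Rightarrow> 'a" where
  "gp_conv f g e = (\<Sum>x | f x \<noteq> 0 \<and> g (e - x) \<noteq> 0. f x * g (e - x))"

lemma gp_conv_superset:
  assumes "well_ordered S" "well_ordered T" "{e. f e \<noteq> 0} \<subseteq> S" "{e. g e \<noteq> 0} \<subseteq> T"
  shows "gp_conv f g e = (\<Sum>x | x \<in> S \<and> e - x \<in> T. f x * g (e - x))"
  unfolding gp_conv_def
  by (rule sum.mono_neutral_left) (use assms well_ordered_finite_decomp in auto)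

lemma gp_conv_supp:
  "{e. gp_conv f g e \<noteq> 0} \<subseteq> {x + y |x y. x \<in> {e. f e \<noteq> 0} \<and> y \<in> {e. g e \<noteq> 0}}"
proof
  fix e assume "e \<in> {e. gp_conv f g e \<noteq> 0}"
  then have "{x. f x \<noteq> 0 \<and> g (e - x) \<noteq> 0} \<noteq> {}"
    by (auto simp: gp_conv_def simp del: Collect_empty_eq)
  then obtain x where "f x \<noteq> 0" "g (e - x) \<noteq> 0" by blast
  then have "e = x + (e - x) \<and> x \<in> {e. f e \<noteq> 0} \<and> e - x \<in> {e. g e \<noteq> 0}" by simp
  then show "e \<in> {x + y |x y. x \<in> {e. f e \<noteq> 0} \<and> y \<in> {e. g e \<noteq> 0}}" by blast
qed

instantiation gpuiseux :: (comm_ring_1) comm_ring_1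
begin

lift_definition times_gpuiseux :: "'a gpuiseux \<Rightarrow> 'a gpuiseux \<Rightarrow> 'a gpuiseux" is gp_conv
  by (rule well_ordered_subset[OF well_ordered_plus gp_conv_supp])

lemma gp_coeff_times: "gp_coeff (a * b) = gp_conv (gp_coeff a) (gp_coeff b)"
  by transfer simp

lemma gp_coeff_times_superset:
  assumes "well_ordered S" "well_ordered T" "gp_supp a \<subseteq> S" "gp_supp b \<subseteq> T"
  shows "gp_coeff (a * b) e = (\<Sum>x | x \<in> S \<and> e - x \<in> T. gp_coeff a x * gp_coeff b (e - x))"
  unfolding gp_coeff_times
  by (rule gp_conv_superset) (use assms in \<open>auto simp: gp_supp_def\<close>)

lemma gp_supp_times: "gp_supp (a * b) \<subseteq> {x + y |x y. x \<in> gp_supp a \<and> y \<in> gp_supp b}"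
  unfolding gp_supp_def gp_coeff_times by (rule gp_conv_supp)

lemma gp_times_commute: "a * b = b * (a :: 'a gpuiseux)"
proof (rule gp_eqI)
  fix e
  show "gp_coeff (a * b) e = gp_coeff (b * a) e"
    unfolding gp_coeff_times gp_conv_def
    by (rule sum.reindex_bij_witness[of _ "\<lambda>x. e - x" "\<lambda>x. e - x"]) (auto simp: mult.commute)
qed

lemma gp_times_assoc: "(a * b) * c = a * (b * (c :: 'a gpuiseux))"
proof (rule gp_eqI)
  fix e
  let ?A = "gp_supp a" and ?B = "gp_supp b" and ?C = "gp_supp c"
  let ?AB = "{x + y |x y. x \<in> ?A \<and> y \<in> ?B}" and ?BC = "{x + y |x y. x \<in> ?B \<and> y \<in> ?C}"
  note wo = well_ordered_gp_supp
  note wo2 = well_ordered_plus[OF wo wo]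
  have "gp_coeff ((a * b) * c) e =
      (\<Sum>s | s \<in> ?AB \<and> e - s \<in> ?C. gp_coeff (a * b) s * gp_coeff c (e - s))"
    by (rule gp_coeff_times_superset[OF wo2 wo gp_supp_times order_refl])
  also have "\<dots> = (\<Sum>s | s \<in> ?AB \<and> e - s \<in> ?C. \<Sum>x | x \<in> ?A \<and> s - x \<in> ?B.
      gp_coeff a x * gp_coeff b (s - x) * gp_coeff c (e - s))"
    by (simp only: gp_coeff_times_superset[OF wo wo order_refl order_refl, of a b] sum_distrib_right)
  also have "\<dots> = (\<Sum>(s, x) \<in> (SIGMA s : {s. s \<in> ?AB \<and> e - s \<in> ?C}. {x. x \<in> ?A \<and> s - x \<in> ?B}).
      gp_coeff a x * gp_coeff b (s - x) * gp_coeff c (e - s))"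
    by (rule sum.Sigma; (intro ballI)?;
        rule well_ordered_finite_decomp[OF wo2 wo] well_ordered_finite_decomp[OF wo wo])
  also have "\<dots> = (\<Sum>(x, y) \<in> (SIGMA x : {x. x \<in> ?A \<and> e - x \<in> ?BC}. {y. y \<in> ?B \<and> e - x - y \<in> ?C}).
      gp_coeff a x * (gp_coeff b y * gp_coeff c (e - x - y)))"
  proof (rule sum.reindex_bij_witness[of _ "\<lambda>(x, y). (x + y, x)" "\<lambda>(s, x). (x, s - x)"], goal_cases)
    case (2 p)
    obtain s x where p: "p = (s, x)" by (cases p)
    have h: "e - s \<in> ?C" "x \<in> ?A" "s - x \<in> ?B" using 2 p by auto
    have "e - x = (s - x) + (e - s)" by simp
    then have "e - x \<in> ?BC" using h by blast
    then show ?case using p h by simp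
  next
    case (4 p)
    obtain x y where p: "p = (x, y)" by (cases p)
    have h: "x \<in> ?A" "y \<in> ?B" "e - x - y \<in> ?C" using 4 p by auto
    have "x + y \<in> ?AB" using h by blast
    then show ?case using p h by (simp add: diff_diff_eq)
  next
    case (5 p)
    obtain s x where p: "p = (s, x)" by (cases p)
    have "e - x - (s - x) = e - s" by simp
    then show ?case using p by (simp only: prod.case mult.assoc)
  qed auto
  also have "\<dots> = (\<Sum>x | x \<in> ?A \<and> e - x \<in> ?BC. \<Sum>y | y \<in> ?B \<and> e - x - y \<in> ?C.
      gp_coeff a x * (gp_coeff b y * gp_coeff c (e - x - y)))"
    by (rule sum.Sigma[symmetric]; (intro ballI)?;
        rule well_ordered_finite_decomp[OF wo wo2] well_ordered_finite_decomp[OF wo wo])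
  also have "\<dots> = (\<Sum>x | x \<in> ?A \<and> e - x \<in> ?BC. gp_coeff a x * gp_coeff (b * c) (e - x))"
    by (simp only: gp_coeff_times_superset[OF wo wo order_refl order_refl, of b c] sum_distrib_left)
  also have "\<dots> = gp_coeff (a * (b * c)) e"
    by (rule gp_coeff_times_superset[OF wo wo2 order_refl gp_supp_times, symmetric])
  finally show "gp_coeff ((a * b) * c) e = gp_coeff (a * (b * c)) e" .
qed

lemma gp_one_times: "1 * a = (a :: 'a gpuiseux)"
proof (rule gp_eqI)
  fix e
  have "gp_coeff (1 * a) e =
      (\<Sum>x | x \<in> {0} \<and> e - x \<in> gp_supp a. gp_coeff 1 x * gp_coeff a (e - x))"
    by (rule gp_coeff_times_superset)
      (use well_ordered_gp_supp[of a] in \<open>auto simp: gp_supp_def gp_coeff_one split: if_splits\<close>)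
  also have "\<dots> = gp_coeff a e"
  proof (cases "e \<in> gp_supp a")
    case True
    then have "{x. x \<in> {0} \<and> e - x \<in> gp_supp a} = {0}" by auto
    then show ?thesis by (simp only:) (simp add: gp_coeff_one)
  next
    case False
    then have "{x. x \<in> {0} \<and> e - x \<in> gp_supp a} = {}" by auto
    then show ?thesis using False by (simp only:) (simp add: gp_supp_def)
  qed
  finally show "gp_coeff (1 * a) e = gp_coeff a e" .
qed

lemma gp_distrib: "(a + b) * c = a * c + b * (c :: 'a gpuiseux)"
proof (rule gp_eqI)
  fix e
  let ?S = "gp_supp a \<union> gp_supp b" and ?T = "gp_supp c"
  note wo = well_ordered_gp_supp
  have "gp_supp (a + b) \<subseteq> ?S" by (auto simp: gp_supp_def)
  then show "gp_coeff ((a + b) * c) e = gp_coeff (a * c + b * c) e"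
    using gp_coeff_times_superset[OF well_ordered_Un[OF wo wo] wo, of "a + b" a b c c e]
      gp_coeff_times_superset[OF well_ordered_Un[OF wo wo] wo, of a a b c c e]
      gp_coeff_times_superset[OF well_ordered_Un[OF wo wo] wo, of b a b c c e]
    by (simp add: distrib_right sum.distrib)
qed

instance
proof
  fix a b c :: "'a gpuiseux"
  show "a * b * c = a * (b * c)" by (rule gp_times_assoc)
  show "a * b = b * a" by (rule gp_times_commute)
  show "1 * a = a" by (rule gp_one_times)
  show "(a + b) * c = a * c + b * c" by (rule gp_distrib)
  show "(0 :: 'a gpuiseux) \<noteq> 1"
  proof
    assume "(0 :: 'a gpuiseux) = 1"
    then have "gp_coeff (0 :: 'a gpuiseux) 0 = gp_coeff 1 0" by simp
    then show False by (simp add: gp_coeff_one)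
  qed
qed

end

lift_definition gp_monom :: "'a::zero \<Rightarrow> real \<Rightarrow> 'a gpuiseux" is
  "\<lambda>c e x. if x = e then c else 0"
  by (rule well_ordered_subset[of "{e}" for e]) auto

lemma gp_coeff_monom: "gp_coeff (gp_monom c e) x = (if x = e then c else 0)"
  by transfer simp

lemma gp_coeff_monom_times:
  fixes a :: "'a::comm_ring_1 gpuiseux"
  shows "gp_coeff (gp_monom c d * a) e = c * gp_coeff a (e - d)"
proof -
  have "gp_coeff (gp_monom c d * a) e =
      (\<Sum>x | x \<in> {d} \<and> e - x \<in> gp_supp a. gp_coeff (gp_monom c d) x * gp_coeff a (e - x))"
    by (rule gp_coeff_times_superset)
      (use well_ordered_gp_supp[of a] in \<open>auto simp: gp_supp_def gp_coeff_monom split: if_splits\<close>)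
  also have "\<dots> = c * gp_coeff a (e - d)"
  proof (cases "e - d \<in> gp_supp a")
    case True
    then have "{x. x \<in> {d} \<and> e - x \<in> gp_supp a} = {d}" by auto
    then show ?thesis by (simp only:) (simp add: gp_coeff_monom)
  next
    case False
    then have "{x. x \<in> {d} \<and> e - x \<in> gp_supp a} = {}" by auto
    then show ?thesis using False by (simp only:) (simp add: gp_supp_def)
  qed
  finally show ?thesis .
qed

lemma gp_supp_power:
  fixes u :: "'a::comm_ring_1 gpuiseux"
  assumes "\<And>x. x \<in> gp_supp u \<Longrightarrow> d \<le> x" "x \<in> gp_supp (u ^ n)"
  shows "real n * d \<le> x"
  using assms(2)
proof (induction n arbitrary: x)
  case 0
  then show ?case by (simp add: gp_supp_def gp_coeff_one split: if_splits)
next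
  case (Suc n)
  then have "x \<in> {x + y |x y. x \<in> gp_supp u \<and> y \<in> gp_supp (u ^ n)}"
    using gp_supp_times[of u "u ^ n"] by auto
  then obtain y z where "x = y + z" "y \<in> gp_supp u" "z \<in> gp_supp (u ^ n)" by blast
  then show ?case using Suc.IH[of z] assms(1)[of y] by (simp add: algebra_simps)
qed

lemma gp_times_cong_le:
  fixes a b c :: "'a::comm_ring_1 gpuiseux"
  assumes "\<And>x. x \<in> gp_supp a \<Longrightarrow> 0 \<le> x" "\<And>y. y \<le> e \<Longrightarrow> gp_coeff b y = gp_coeff c y"
  shows "gp_coeff (a * b) e = gp_coeff (a * c) e"
  unfolding gp_coeff_times gp_conv_def
  by (rule sum.cong) (use assms in \<open>auto simp: gp_supp_def\<close>)

text \<open>As the exponents are real, the geometric series of a series with positive support is a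
  finite sum in every degree.\<close>

lemma gp_inverse_one_minus:
  fixes u :: "'a::comm_ring_1 gpuiseux"
  assumes d: "d > 0" "\<And>x. x \<in> gp_supp u \<Longrightarrow> d \<le> x"
  shows "\<exists>v. (1 - u) * v = 1"
proof -
  define N :: "real \<Rightarrow> nat" where "N x = nat \<lceil>x / d\<rceil> + 1" for x
  have N: "x < real n * d" if "N x \<le> n" for x n
  proof -
    have "x / d < real n" using that unfolding N_def by linarith
    then show ?thesis using d(1) by (simp add: divide_less_eq)
  qed
  have Nmono: "N y \<le> N x" if "y \<le> x" for x y
  proof -
    have "y / d \<le> x / d" using that d(1) by (simp add: divide_right_mono)
    then show ?thesis unfolding N_def by (intro add_right_mono nat_mono ceiling_mono)
  qed
  have zero: "gp_coeff (u ^ n) x = 0" if "N x \<le> n" for x n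
  proof (rule ccontr)
    assume "gp_coeff (u ^ n) x \<noteq> 0"
    then have "real n * d \<le> x" using gp_supp_power[of u d x n] d(2) by (simp add: gp_supp_def)
    then show False using N[OF that] by simp
  qed
  have stable: "gp_coeff (\<Sum>i<n. u ^ i) x = gp_coeff (\<Sum>i<N x. u ^ i) x" if "N x \<le> n" for x n
    unfolding gp_coeff_sum
    by (rule sum.mono_neutral_right) (use that zero in auto)
  define g where "g x = gp_coeff (\<Sum>i<N x. u ^ i) x" for x
  have "well_ordered {x. g x \<noteq> 0}"
    unfolding well_ordered_def
  proof (intro allI impI)
    fix T assume T: "T \<subseteq> {x. g x \<noteq> 0}" "T \<noteq> {}"
    then obtain t where t: "t \<in> T" by blast
    have "{x \<in> T. x \<le> t} \<subseteq> gp_supp (\<Sum>i<N t. u ^ i)"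
    proof
      fix x assume "x \<in> {x \<in> T. x \<le> t}"
      then have "g x \<noteq> 0" "x \<le> t" using T by auto
      then show "x \<in> gp_supp (\<Sum>i<N t. u ^ i)"
        using stable[OF Nmono, of x t] by (simp add: gp_supp_def g_def)
    qed
    moreover have "{x \<in> T. x \<le> t} \<noteq> {}" using t by blast
    ultimately have "\<exists>m\<in>{x \<in> T. x \<le> t}. \<forall>x\<in>{x \<in> T. x \<le> t}. m \<le> x"
      by (rule well_ordered_least[OF well_ordered_gp_supp])
    then obtain m where m: "m \<in> {x \<in> T. x \<le> t}" "\<And>x. x \<in> {x \<in> T. x \<le> t} \<Longrightarrow> m \<le> x"
      by blast
    have "m \<le> x" if "x \<in> T" for x
      using m(1) m(2)[of x] that by (cases "x \<le> t") auto
    then show "\<exists>m\<in>T. \<forall>x\<in>T. m \<le> x" using m(1) by blast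
  qed
  then have g: "gp_coeff (Abs_gpuiseux g) = g" by (rule gp_coeff_Abs)
  have "(1 - u) * Abs_gpuiseux g = 1"
  proof (rule gp_eqI)
    fix e
    have "gp_coeff ((1 - u) * Abs_gpuiseux g) e = gp_coeff ((1 - u) * (\<Sum>i<N e. u ^ i)) e"
    proof (rule gp_times_cong_le)
      fix x assume "x \<in> gp_supp (1 - u)"
      then have "x = 0 \<or> x \<in> gp_supp u" by (auto simp: gp_supp_def gp_coeff_one split: if_splits)
      then show "0 \<le> x" using d by force
    next
      fix y assume "y \<le> e"
      then show "gp_coeff (Abs_gpuiseux g) y = gp_coeff (\<Sum>i<N e. u ^ i) y"
        unfolding g using stable[OF Nmono, of y e] by (simp add: g_def)
    qed
    also have "\<dots> = gp_coeff (1 - u ^ N e) e" by (simp only: one_diff_power_eq)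
    also have "\<dots> = gp_coeff 1 e" using zero[of e "N e"] by simp
    finally show "gp_coeff ((1 - u) * Abs_gpuiseux g) e = gp_coeff 1 e" .
  qed
  then show ?thesis by blast
qed

lemma gp_inverse_exists:
  fixes a :: "'a::field gpuiseux"
  assumes "a \<noteq> 0"
  shows "\<exists>b. a * b = 1"
proof -
  have "gp_supp a \<noteq> {}" using assms gp_eqI[of a 0] by (auto simp: gp_supp_def)
  then obtain m where m: "m \<in> gp_supp a" "\<And>x. x \<in> gp_supp a \<Longrightarrow> m \<le> x"
    using well_ordered_least[OF well_ordered_gp_supp order_refl] by blast
  define w where "w = gp_monom (inverse (gp_coeff a m)) (- m)"
  define u where "u = 1 - w * a"
  have coeff_u: "gp_coeff u x = (if x = 0 then 1 else 0) - inverse (gp_coeff a m) * gp_coeff a (x + m)" for x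
    by (simp add: u_def w_def gp_coeff_monom_times gp_coeff_one)
  have u_pos: "0 < x" if "x \<in> gp_supp u" for x
  proof -
    have "x \<noteq> 0" using that m(1) by (auto simp: gp_supp_def coeff_u)
    then have "x + m \<in> gp_supp a" using that by (auto simp: gp_supp_def coeff_u)
    then have "0 \<le> x" using m(2)[of "x + m"] by simp
    then show ?thesis using \<open>x \<noteq> 0\<close> by simp
  qed
  have "\<exists>d>0. \<forall>x\<in>gp_supp u. d \<le> x"
  proof (cases "gp_supp u = {}")
    case True
    then show ?thesis by (auto intro: exI[of _ 1])
  next
    case False
    then obtain d where "d \<in> gp_supp u" "\<And>x. x \<in> gp_supp u \<Longrightarrow> d \<le> x"
      using well_ordered_least[OF well_ordered_gp_supp order_refl] by blast
    then show ?thesis using u_pos by blast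
  qed
  then obtain d where "d > 0" "\<And>x. x \<in> gp_supp u \<Longrightarrow> d \<le> x" by blast
  then obtain v where "(1 - u) * v = 1" using gp_inverse_one_minus[of d u] by blast
  then have "(w * a) * v = 1" by (simp add: u_def)
  then have "a * (w * v) = 1" by (simp only: ac_simps)
  then show ?thesis by blast
qed

instantiation gpuiseux :: (field) field
begin

definition inverse_gpuiseux :: "'a gpuiseux \<Rightarrow> 'a gpuiseux" where
  "inverse_gpuiseux a = (if a = 0 then 0 else (THE b. a * b = 1))"

definition divide_gpuiseux :: "'a gpuiseux \<Rightarrow> 'a gpuiseux \<Rightarrow> 'a gpuiseux" where
  "divide_gpuiseux a b = a * inverse b"

instance
proof
  fix a b :: "'a gpuiseux"
  show "inverse a * a = 1" if nz: "a \<noteq> 0"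
  proof -
    obtain b where b: "a * b = 1" using gp_inverse_exists[OF nz] by blast
    have uniq: "c = b" if "a * c = 1" for c
    proof -
      have "c = (a * b) * c" using b by simp
      also have "\<dots> = b * (a * c)" by (simp only: ac_simps)
      finally show ?thesis using that by simp
    qed
    have "(THE b. a * b = 1) = b" using b uniq by (rule the_equality)
    then show ?thesis using nz b by (simp add: inverse_gpuiseux_def mult.commute)
  qed
  show "a div b = a * inverse b" by (rule divide_gpuiseux_def)
  show "inverse (0 :: 'a gpuiseux) = 0" by (simp add: inverse_gpuiseux_def)
qed

end

definition gp_deg :: "'a::zero gpuiseux \<Rightarrow> ereal" where
  "gp_deg a = (if a = 0 then \<infinity> else ereal (LEAST e. e \<in> gp_supp a))"

lemma gp_deg_zero: "gp_deg 0 = \<infinity>"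
  by (simp add: gp_deg_def)

lemma gp_deg_monom:
  assumes "c \<noteq> 0"
  shows "gp_deg (gp_monom c e) = ereal e"
proof -
  have "gp_supp (gp_monom c e) = {e}" using assms by (auto simp: gp_supp_def gp_coeff_monom)
  moreover have "gp_monom c e \<noteq> 0"
  proof
    assume "gp_monom c e = 0"
    then have "gp_coeff (gp_monom c e) e = 0" by simp
    then show False using assms by (simp add: gp_coeff_monom)
  qed
  moreover have "(LEAST x. x = e) = e" by (rule Least_equality) auto
  ultimately show ?thesis by (simp add: gp_deg_def)
qed

section \<open>Tropical matrices\<close>

text \<open>The tropical semiring is the set of extended reals other than \<open>-\<infinity>\<close>.\<close>

definition tropical_mat :: "nat \<Rightarrow> nat \<Rightarrow> ereal mat set" where
  "tropical_mat m n = {A \<in> carrier_mat m n. \<forall>i<m. \<forall>j<n. A $$ (i, j) \<noteq> -\<infinity>}"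

definition perm_weight :: "ereal mat \<Rightarrow> (nat \<Rightarrow> nat) \<Rightarrow> ereal" where
  "perm_weight B \<sigma> = (\<Sum>p<dim_row B. B $$ (p, \<sigma> p))"

definition tropical_det :: "ereal mat \<Rightarrow> ereal" where
  "tropical_det B = Min (perm_weight B ` {\<sigma>. \<sigma> permutes {..<dim_row B}})"

definition tropically_nonsingular :: "ereal mat \<Rightarrow> bool" where
  "tropically_nonsingular B \<longleftrightarrow> square_mat B \<and> \<bar>tropical_det B\<bar> \<noteq> \<infinity> \<and>
    (\<exists>!\<sigma>. \<sigma> permutes {..<dim_row B} \<and> perm_weight B \<sigma> = tropical_det B)"

text \<open>The empty matrix is non-singular, so a matrix without a finite entry has rank 0.\<close>

definition tropical_rank :: "ereal mat \<Rightarrow> nat" where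
  "tropical_rank A = Max {m. \<exists>I J. I \<subseteq> {..<dim_row A} \<and> J \<subseteq> {..<dim_col A} \<and>
    card I = m \<and> card J = m \<and> tropically_nonsingular (submatrix A I J)}"

text \<open>The first argument only names the coefficient field.\<close>

definition kapranov_rank :: "'f::field itself \<Rightarrow> ereal mat \<Rightarrow> nat" where
  "kapranov_rank F A = (LEAST r. \<exists>L :: 'f gpuiseux mat.
    L \<in> carrier_mat (dim_row A) (dim_col A) \<and>
    (\<forall>i<dim_row A. \<forall>j<dim_col A. gp_deg (L $$ (i, j)) = A $$ (i, j)) \<and>
    vec_space.rank (dim_row A) L = r)"

text \<open>The set under the maximum is finite and nonempty, and the one under the minimum is nonempty.\<close>

lemma tropical_rank_finite:
  "finite {m. \<exists>I J. I \<subseteq> {..<dim_row A} \<and> J \<subseteq> {..<dim_col A} \<and>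
    card I = m \<and> card J = m \<and> tropically_nonsingular (submatrix A I J)}"
proof (rule finite_subset)
  show "{m. \<exists>I J. I \<subseteq> {..<dim_row A} \<and> J \<subseteq> {..<dim_col A} \<and>
      card I = m \<and> card J = m \<and> tropically_nonsingular (submatrix A I J)} \<subseteq> {..dim_row A}"
    using card_mono[of "{..<dim_row A}"] by fastforce
qed simp

lemma tropically_nonsingular_empty: "tropically_nonsingular (submatrix A {} {})"
  by (simp add: tropically_nonsingular_def tropical_det_def perm_weight_def dim_submatrix)

lemma kapranov_lift_exists:
  assumes "A \<in> tropical_mat m n"
  shows "\<exists>L \<in> carrier_mat m n. \<forall>i<m. \<forall>j<n.
    gp_deg (L $$ (i, j) :: 'f::field gpuiseux) = A $$ (i, j)"
proof (intro bexI[of _ "mat m n (\<lambda>p. if A $$ p = \<infinity> then 0 else gp_monom 1 (real_of_ereal (A $$ p)))"]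
    allI impI)
  fix i j assume ij: "i < m" "j < n"
  then have "A $$ (i, j) \<noteq> -\<infinity>" using assms by (simp add: tropical_mat_def)
  then show "gp_deg (mat m n (\<lambda>p. if A $$ p = \<infinity> then 0 else gp_monom 1 (real_of_ereal (A $$ p)))
      $$ (i, j) :: 'f gpuiseux) = A $$ (i, j)"
    using ij by (cases "A $$ (i, j)") (simp_all add: gp_deg_monom gp_deg_zero)
qed simp

end

theory Submission
  imports Defs "HOL-Analysis.Continuum_Not_Denumerable"
begin

text \<open>The matrix is \<open>0\<close> on a set \<open>Z\<close> of at most \<open>\<alpha>\<^sup>2 n\<^sup>2\<close> positions, and its other
  entries are real numbers in \<open>(1, 2)\<close> that are linearly independent over the rationals.

  If \<open>Z\<close> meets every \<open>c \<times> c\<close> square, then the tropical rank is less than \<open>3 c\<close>.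
  A greedy hitting set argument yields such a \<open>Z\<close> with \<open>c\<close> about \<open>4 ln n / \<alpha>\<^sup>2\<close>.

  In a lift of rank \<open>r\<close>, all entries are polynomials of degree at most 2 in
  \<open>n\<^sup>2 - (n - r)\<^sup>2\<close> elements, while the entries outside \<open>Z\<close> are algebraically independent over
  the coefficient field because distinct monomials in them have distinct degrees. Comparing the
  number of monomials with the dimension of their span gives \<open>n\<^sup>2 - |Z| \<le> n\<^sup>2 - (n - r)\<^sup>2\<close>,
  hence \<open>n - r \<le> \<alpha> n\<close>.\<close>

section \<open>Algebraic independence\<close>

definition monomial :: "'i set \<Rightarrow> ('i \<Rightarrow> 'a::comm_monoid_mult) \<Rightarrow> ('i \<Rightarrow> nat) \<Rightarrow> 'a" where
  "monomial I y h = (\<Prod>i\<in>I. y i ^ h i)"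

lemma monomial_restrict: "monomial I y (restrict h I) = monomial I y h"
  by (simp add: monomial_def)

lemma monomial_add: "monomial I y (\<lambda>i. g i + h i) = monomial I y g * monomial I y h"
  by (simp add: monomial_def power_add prod.distrib)

lemma monomial_zero: "monomial I y (\<lambda>i. 0) = 1"
  by (simp add: monomial_def)

lemma monomial_unit:
  assumes "finite I" "i \<in> I"
  shows "monomial I y (\<lambda>j. if j = i then 1 else 0) = y i"
  using assms by (simp add: monomial_def if_distrib[of "\<lambda>k. _ ^ k"] prod.delta cong: if_cong)

lemma exponent_le_if_power_le:
  fixes m n a :: nat
  assumes power: "\<And>D. D ^ m \<le> (a * D + 1) ^ n"
  shows "m \<le> n"
proof (rule ccontr)
  assume "\<not> m \<le> n"
  define D where "D = (a + 1) ^ n + 1"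
  have "D * D ^ n \<le> D ^ m"
    using \<open>\<not> m \<le> n\<close> power_increasing[of "Suc n" m D] by (simp add: D_def)
  also have "\<dots> \<le> (a * D + 1) ^ n" by (rule power)
  also have "\<dots> \<le> ((a + 1) * D) ^ n" by (intro power_mono) (auto simp: D_def)
  also have "\<dots> = (a + 1) ^ n * D ^ n" by (rule power_mult_distrib)
  finally show False by (simp add: D_def)
qed

locale commutative_algebra = vector_space scale
  for scale :: "'k::field \<Rightarrow> 'a::comm_ring_1 \<Rightarrow> 'a" +
  assumes scale_mult_left: "scale c x * y = scale c (x * y)"
begin

lemma subspace_mult_in_span: "subspace {b. a * b \<in> span W}"
proof (rule subspaceI)
  fix c b assume "b \<in> {b. a * b \<in> span W}"
  moreover have "a * scale c b = scale c (a * b)"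
    using scale_mult_left[of c b a] by (simp add: mult.commute)
  ultimately show "scale c b \<in> {b. a * b \<in> span W}" by (simp add: span_scale)
qed (auto simp: span_zero distrib_left span_add)

lemma span_mult:
  assumes prod: "\<And>x y. x \<in> X \<Longrightarrow> y \<in> Y \<Longrightarrow> x * y \<in> span W"
    and in_X: "a \<in> span X" and in_Y: "b \<in> span Y"
  shows "a * b \<in> span W"
proof -
  have "x * b \<in> span W" if "x \<in> X" for x
    using span_minimal[OF _ subspace_mult_in_span, of Y x W] prod[OF that] in_Y by auto
  then have "X \<subseteq> {a. b * a \<in> span W}" by (auto simp: mult.commute)
  then show ?thesis
    using span_minimal[OF _ subspace_mult_in_span, of X b W] in_X by (auto simp: mult.commute)
qed

definition poly_span :: "'i set \<Rightarrow> ('i \<Rightarrow> 'a) \<Rightarrow> nat \<Rightarrow> 'a set" where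
  "poly_span I y k = span (monomial I y ` (I \<rightarrow>\<^sub>E {..k}))"

lemma monomial_in_poly_span:
  assumes "\<And>i. i \<in> I \<Longrightarrow> h i \<le> k"
  shows "monomial I y h \<in> poly_span I y k"
  unfolding poly_span_def
  by (rule span_base, rule image_eqI[of _ _ "restrict h I"])
    (use assms in \<open>auto simp: monomial_restrict\<close>)

lemma poly_span_mult:
  assumes "a \<in> poly_span I y j" "b \<in> poly_span I y k"
  shows "a * b \<in> poly_span I y (j + k)"
  using _ assms unfolding poly_span_def
proof (rule span_mult)
  fix v w assume "v \<in> monomial I y ` (I \<rightarrow>\<^sub>E {..j})" "w \<in> monomial I y ` (I \<rightarrow>\<^sub>E {..k})"
  then obtain g h where "v * w = monomial I y (\<lambda>i. g i + h i)"
    and "g \<in> I \<rightarrow>\<^sub>E {..j}" "h \<in> I \<rightarrow>\<^sub>E {..k}"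
    by (auto simp: monomial_add)
  then show "v * w \<in> span (monomial I y ` (I \<rightarrow>\<^sub>E {..j + k}))"
    using monomial_in_poly_span[of I "\<lambda>i. g i + h i" "j + k" y]
    by (auto simp: poly_span_def PiE_iff add_mono)
qed

lemma poly_span_mono: "j \<le> k \<Longrightarrow> poly_span I y j \<subseteq> poly_span I y k"
  unfolding poly_span_def by (intro span_mono image_mono PiE_mono) auto

lemma one_in_poly_span: "1 \<in> poly_span I y k"
  using monomial_in_poly_span[of I "\<lambda>i. 0" k y] by (simp add: monomial_zero)

lemma variable_in_poly_span:
  assumes "finite I" "i \<in> I"
  shows "y i \<in> poly_span I y 1"
  by (subst monomial_unit[OF assms, symmetric]) (rule monomial_in_poly_span, simp)

lemma poly_span_sum:
  "(\<And>s. s \<in> S \<Longrightarrow> f s \<in> poly_span I y k) \<Longrightarrow> sum f S \<in> poly_span I y k"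
  unfolding poly_span_def by (rule span_sum)

lemma poly_span_power: "a \<in> poly_span I y k \<Longrightarrow> a ^ d \<in> poly_span I y (d * k)"
  by (induction d) (auto intro: one_in_poly_span poly_span_mult)

lemma poly_span_prod:
  "(\<And>t. t \<in> T \<Longrightarrow> a t \<in> poly_span I y (k t)) \<Longrightarrow> prod a T \<in> poly_span I y (sum k T)"
  by (induction T rule: infinite_finite_induct) (auto intro: one_in_poly_span poly_span_mult)

lemma monomial_of_poly_span:
  assumes elements: "\<And>t. t \<in> T \<Longrightarrow> x t \<in> poly_span I y b" and bounded: "\<And>t. t \<in> T \<Longrightarrow> e t \<le> D"
  shows "monomial T x e \<in> poly_span I y (card T * D * b)"
proof -
  have "monomial T x e \<in> poly_span I y (\<Sum>t\<in>T. e t * b)"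
    unfolding monomial_def using elements by (intro poly_span_prod poly_span_power)
  moreover have "(\<Sum>t\<in>T. e t * b) \<le> (\<Sum>t\<in>T. D * b)"
    using bounded by (intro sum_mono mult_right_mono) auto
  ultimately show ?thesis
    using poly_span_mono[of "\<Sum>t\<in>T. e t * b" "card T * D * b" I y] by (auto simp: mult.assoc)
qed

definition algebraically_independent :: "'t set \<Rightarrow> ('t \<Rightarrow> 'a) \<Rightarrow> bool" where
  "algebraically_independent T x \<longleftrightarrow>
    inj_on (monomial T x) (T \<rightarrow>\<^sub>E UNIV) \<and> independent (monomial T x ` (T \<rightarrow>\<^sub>E UNIV))"

lemma card_le_if_algebraically_independent:
  assumes fin: "finite T" "finite I"
    and indep: "algebraically_independent T x"
    and elements: "\<And>t. t \<in> T \<Longrightarrow> x t \<in> poly_span I y b"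
  shows "card T \<le> card I"
proof (rule exponent_le_if_power_le)
  fix D
  let ?X = "monomial T x ` (T \<rightarrow>\<^sub>E {..<D})"
  let ?Y = "monomial I y ` (I \<rightarrow>\<^sub>E {..card T * D * b})"
  have sub: "T \<rightarrow>\<^sub>E {..<D} \<subseteq> T \<rightarrow>\<^sub>E UNIV" by (rule PiE_mono) simp
  have "card ?X = D ^ card T"
    using indep fin(1) inj_on_subset[OF _ sub, of "monomial T x"]
    by (simp add: algebraically_independent_def card_image card_PiE)
  moreover have "card ?X \<le> card ?Y"
  proof (rule independent_span_bound[THEN conjunct2])
    show "finite ?Y" using fin(2) by (simp add: finite_PiE)
    show "independent ?X"
      using indep independent_mono[OF _ image_mono[OF sub]]
      by (simp add: algebraically_independent_def)
    show "?X \<subseteq> span ?Y"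
      using monomial_of_poly_span[OF elements, of T]
      by (auto simp: poly_span_def PiE_iff less_imp_le)
  qed
  moreover have "card ?Y \<le> (card T * D * b + 1) ^ card I"
    using card_image_le[OF finite_PiE, of I "\<lambda>_. {..card T * D * b}" "monomial I y"] fin(2)
    by (simp add: card_PiE)
  ultimately show "D ^ card T \<le> (card T * b * D + 1) ^ card I" by (simp add: ac_simps)
qed

end

section \<open>Algebraically independent entries of a matrix of given rank\<close>

lemma (in vec_space) maximal_lin_indpt_spans:
  assumes carrier: "X \<subseteq> carrier_vec n" and max: "maximal S (\<lambda>T. T \<subseteq> X \<and> lin_indpt T)"
  shows "X \<subseteq> span S"
proof
  fix v assume v: "v \<in> X"
  have indpt: "S \<subseteq> X" "lin_indpt S" using max by (auto simp: maximal_def)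
  then have S_carrier: "S \<subseteq> carrier_vec n" using carrier by blast
  show "v \<in> span S"
  proof (cases "v \<in> S")
    case True
    then show ?thesis using span_mem S_carrier by auto
  next
    case False
    then have "\<not> lin_indpt (S \<union> {v})"
      using max indpt v unfolding maximal_def by blast
    then show ?thesis using lin_dep_iff_in_span[of S v] S_carrier indpt(2) False v carrier by auto
  qed
qed

lemma (in vec_space) rank_column_basis:
  assumes A: "A \<in> carrier_mat n nc"
  obtains C where "C \<subseteq> {..<nc}" "card C = rank A" "inj_on (col A) C"
    "set (cols A) \<subseteq> span (col A ` C)"
proof -
  have cols: "set (cols A) = col A ` {..<nc}" using A by (auto simp: cols_def)
  have "lin_indpt {}" by (simp add: lin_dep_def)
  then obtain S where max: "maximal S (\<lambda>T. T \<subseteq> set (cols A) \<and> lin_indpt T)"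
    using maximal_exists_superset[of "set (cols A)" "\<lambda>T. T \<subseteq> set (cols A) \<and> lin_indpt T" "{}"]
    by auto
  then have "S \<subseteq> col A ` {..<nc}" unfolding maximal_def cols by blast
  then obtain C where "C \<subseteq> {..<nc}" "inj_on (col A) C" "S = col A ` C"
    by (meson subset_image_inj)
  moreover have "set (cols A) \<subseteq> span S"
    using maximal_lin_indpt_spans[OF _ max] A cols_dim by blast
  ultimately show thesis
    using that rank_card_indpt[OF A max] by (simp add: card_image)
qed

lemma (in vec_space) rank_column_coefficients:
  assumes A: "A \<in> carrier_mat n nc"
  obtains C X where "C \<subseteq> {..<nc}" "card C = rank A"
    "\<And>i j. i < n \<Longrightarrow> j < nc \<Longrightarrow> A $$ (i, j) = (\<Sum>k\<in>C. X k j * A $$ (i, k))"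
proof -
  obtain C where C: "C \<subseteq> {..<nc}" "card C = rank A" "inj_on (col A) C"
    and spans: "set (cols A) \<subseteq> span (col A ` C)"
    using rank_column_basis[OF A] .
  have fin: "finite (col A ` C)" using C(1) finite_subset by blast
  have carrier: "col A ` C \<subseteq> carrier_vec n" using A C(1) by auto
  have "\<exists>a. \<forall>i<n. A $$ (i, j) = (\<Sum>k\<in>C. a k * A $$ (i, k))" if j: "j < nc" for j
  proof -
    have "col A j \<in> span (col A ` C)" using spans A j by (force simp: cols_def)
    then obtain a where comb: "lincomb a (col A ` C) = col A j"
      using finite_in_span[OF fin, of "col A j"] carrier by auto
    have "A $$ (i, j) = (\<Sum>k\<in>C. a (col A k) * A $$ (i, k))" if i: "i < n" for i
    proof -
      have "A $$ (i, j) = lincomb a (col A ` C) $ i" using comb A i j by simp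
      also have "\<dots> = (\<Sum>x\<in>col A ` C. a x * x $ i)" by (rule lincomb_index[OF i carrier])
      also have "\<dots> = (\<Sum>k\<in>C. a (col A k) * col A k $ i)" using C(3) by (simp add: sum.reindex)
      also have "\<dots> = (\<Sum>k\<in>C. a (col A k) * A $$ (i, k))"
        using A C(1) i by (intro sum.cong) (auto simp: subset_iff)
      finally show ?thesis .
    qed
    then show ?thesis by (intro exI[of _ "\<lambda>k. a (col A k)"]) simp
  qed
  then have "\<forall>j. \<exists>a. j < nc \<longrightarrow> (\<forall>i<n. A $$ (i, j) = (\<Sum>k\<in>C. a k * A $$ (i, k)))" by blast
  then obtain a where "\<And>i j. i < n \<Longrightarrow> j < nc \<Longrightarrow> A $$ (i, j) = (\<Sum>k\<in>C. a j k * A $$ (i, k))"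
    by metis
  then show thesis using that[of C "\<lambda>k j. a j k"] C(1,2) by blast
qed

locale field_extension = commutative_algebra scale
  for scale :: "'k::field \<Rightarrow> 'a::field \<Rightarrow> 'a"
begin

lemma entries_in_poly_span:
  fixes L :: "'a mat"
  assumes L: "L \<in> carrier_mat m n"
  defines "r \<equiv> vec_space.rank m L"
  obtains I :: "(nat \<times> nat + nat \<times> nat) set" and y
  where "finite I" "card I = m * r + r * (n - r)"
    "\<And>i j. i < m \<Longrightarrow> j < n \<Longrightarrow> L $$ (i, j) \<in> poly_span I y 2"
proof -
  obtain C X where C: "C \<subseteq> {..<n}" "card C = r"
    and expansion: "\<And>i j. i < m \<Longrightarrow> j < n \<Longrightarrow> L $$ (i, j) = (\<Sum>k\<in>C. X k j * L $$ (i, k))"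
    using vec_space.rank_column_coefficients[OF L] unfolding r_def by blast
  define I where "I = ({..<m} \<times> C) <+> (C \<times> ({..<n} - C))"
  define y where "y = case_sum (\<lambda>t. L $$ t) (\<lambda>(k, j). X k j)"
  have "finite C" using C(1) finite_subset by blast
  then have finite_card_I: "finite I" "card I = m * r + r * (n - r)"
    using C by (simp_all add: I_def card_Plus card_Diff_subset)
  have basis: "L $$ (i, k) \<in> poly_span I y 1" if "i < m" "k \<in> C" for i k
    using variable_in_poly_span[OF finite_card_I(1), of "Inl (i, k)" y] that
    unfolding I_def y_def by auto
  have coefficient: "X k j \<in> poly_span I y 1" if "j < n" "j \<notin> C" "k \<in> C" for j k
    using variable_in_poly_span[OF finite_card_I(1), of "Inr (k, j)" y] that
    unfolding I_def y_def by auto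
  have "L $$ (i, j) \<in> poly_span I y 2" if ij: "i < m" "j < n" for i j
  proof (cases "j \<in> C")
    case True
    then show ?thesis using basis[OF ij(1)] poly_span_mono[of 1 2 I y] by auto
  next
    case False
    then have "X k j * L $$ (i, k) \<in> poly_span I y 2" if "k \<in> C" for k
      using poly_span_mult[OF coefficient basis] ij that by (simp flip: one_add_one)
    then show ?thesis unfolding expansion[OF ij] by (rule poly_span_sum)
  qed
  then show thesis using that finite_card_I by blast
qed

lemma card_algebraically_independent_entries:
  fixes L :: "'a mat"
  assumes L: "L \<in> carrier_mat m n" and T: "T \<subseteq> {..<m} \<times> {..<n}"
    and indep: "algebraically_independent T (\<lambda>t. L $$ t)"
  shows "card T + (m - vec_space.rank m L) * (n - vec_space.rank m L) \<le> m * n"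
proof (cases "vec_space.rank m L \<le> m")
  case True
  define r where "r = vec_space.rank m L"
  have rank_le: "r \<le> m" "r \<le> n" using True vec_space.rank_le_nc[OF L] by (simp_all add: r_def)
  obtain I :: "(nat \<times> nat + nat \<times> nat) set" and y
    where I: "finite I" "card I = m * r + r * (n - r)"
    and entry: "\<And>i j. i < m \<Longrightarrow> j < n \<Longrightarrow> L $$ (i, j) \<in> poly_span I y 2"
    using entries_in_poly_span[OF L] unfolding r_def by blast
  have "card T \<le> card I"
    using finite_subset[OF T] I(1) indep
  proof (rule card_le_if_algebraically_independent)
    show "L $$ t \<in> poly_span I y 2" if "t \<in> T" for t using entry that T by auto
  qed simp
  moreover have "m * r + r * (n - r) + (m - r) * (n - r) = m * n"
    using rank_le by (auto simp: le_iff_add algebra_simps)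
  ultimately show ?thesis unfolding r_def[symmetric] I(2) by linarith
next
  case False
  then show ?thesis using card_mono[OF _ T] by simp
qed

end

section \<open>Degrees of generalized Puiseux series\<close>

lemma gp_deg_eq_ereal_iff:
  "gp_deg a = ereal d \<longleftrightarrow> gp_coeff a d \<noteq> 0 \<and> (\<forall>x<d. gp_coeff a x = 0)"
proof (cases "a = 0")
  case False
  then have "gp_supp a \<noteq> {}" using gp_eqI[of a 0] by (auto simp: gp_supp_def)
  then obtain m where least: "m \<in> gp_supp a" "\<And>x. x \<in> gp_supp a \<Longrightarrow> m \<le> x"
    using well_ordered_least[OF well_ordered_gp_supp order_refl] by blast
  then have "gp_deg a = ereal m"
    using False by (simp add: gp_deg_def Least_equality)
  moreover have "d = m \<longleftrightarrow> gp_coeff a d \<noteq> 0 \<and> (\<forall>x<d. gp_coeff a x = 0)"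
    using least unfolding gp_supp_def mem_Collect_eq by (metis antisym_conv2 linorder_not_less)
  ultimately show ?thesis by auto
qed (simp add: gp_deg_def)

lemma gp_deg_finite: "a \<noteq> 0 \<Longrightarrow> \<exists>d. gp_deg a = ereal d"
  by (simp add: gp_deg_def)

lemma gp_deg_one: "gp_deg (1 :: 'a::comm_ring_1 gpuiseux) = 0"
  using gp_deg_eq_ereal_iff[of "1 :: 'a gpuiseux" 0] by (simp add: gp_coeff_one)

lemma gp_deg_mult:
  fixes a b :: "'a::idom gpuiseux"
  shows "gp_deg (a * b) = gp_deg a + gp_deg b"
proof (cases "a = 0 \<or> b = 0")
  case False
  then obtain d e where deg_a: "gp_deg a = ereal d" and deg_b: "gp_deg b = ereal e"
    using gp_deg_finite[of a] gp_deg_finite[of b] by blast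
  have lead_a: "gp_coeff a d \<noteq> 0" "\<And>x. gp_coeff a x \<noteq> 0 \<Longrightarrow> d \<le> x"
    and lead_b: "gp_coeff b e \<noteq> 0" "\<And>x. gp_coeff b x \<noteq> 0 \<Longrightarrow> e \<le> x"
    using deg_a deg_b unfolding gp_deg_eq_ereal_iff by (blast intro: leI)+
  have "{x. gp_coeff a x \<noteq> 0 \<and> gp_coeff b (d + e - x) \<noteq> 0} = {d}"
    using lead_a lead_b by force
  then have "gp_coeff (a * b) (d + e) = gp_coeff a d * gp_coeff b e"
    by (simp add: gp_coeff_times gp_conv_def)
  moreover have "gp_coeff (a * b) z = 0" if "z < d + e" for z
  proof -
    have "{x. gp_coeff a x \<noteq> 0 \<and> gp_coeff b (z - x) \<noteq> 0} = {}"
      using lead_a(2) lead_b(2) that by force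
    then show ?thesis unfolding gp_coeff_times gp_conv_def by (simp only: sum.empty)
  qed
  ultimately show ?thesis
    using lead_a(1) lead_b(1) by (simp add: deg_a deg_b gp_deg_eq_ereal_iff)
qed (auto simp: gp_deg_zero)

lemma gp_deg_power:
  fixes a :: "'a::idom gpuiseux"
  shows "gp_deg (a ^ k) = ereal (real k) * gp_deg a"
proof (induction k)
  case (Suc k)
  have "gp_deg (a ^ Suc k) = ereal 1 * gp_deg a + ereal (real k) * gp_deg a"
    using Suc by (simp add: gp_deg_mult flip: one_ereal_def)
  also have "\<dots> = (ereal 1 + ereal (real k)) * gp_deg a"
    by (rule ereal_left_distrib[symmetric]) simp_all
  finally show ?case by simp
qed (simp add: gp_deg_one)

lemma gp_deg_prod:
  fixes a :: "'t \<Rightarrow> 'a::idom gpuiseux"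
  shows "gp_deg (\<Prod>t\<in>T. a t) = (\<Sum>t\<in>T. gp_deg (a t))"
  by (induction T rule: infinite_finite_induct) (simp_all add: gp_deg_one gp_deg_mult)

lemma gp_deg_monomial:
  fixes x :: "'t \<Rightarrow> 'a::idom gpuiseux"
  assumes "\<And>t. t \<in> T \<Longrightarrow> gp_deg (x t) = ereal (g t)"
  shows "gp_deg (monomial T x e) = ereal (\<Sum>t\<in>T. real (e t) * g t)"
  using assms by (simp add: monomial_def gp_deg_prod gp_deg_power)

definition gp_scale :: "'a::comm_ring_1 \<Rightarrow> 'a gpuiseux \<Rightarrow> 'a gpuiseux" where
  "gp_scale c a = gp_monom c 0 * a"

lemma gp_coeff_scale [simp]: "gp_coeff (gp_scale c a) e = c * gp_coeff a e"
  by (simp add: gp_scale_def gp_coeff_monom_times)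

interpretation gp: field_extension "gp_scale :: 'a::field \<Rightarrow> 'a gpuiseux \<Rightarrow> 'a gpuiseux"
proof
  show "gp_scale c x * y = gp_scale c (x * y)" for c :: 'a and x y
    by (simp add: gp_scale_def mult.assoc)
qed (rule gp_eqI; simp add: algebra_simps)+

lemma gp_independent_if_inj_on_gp_deg:
  assumes nonzero: "0 \<notin> S" and inj: "inj_on gp_deg S"
  shows "gp.independent S"
  unfolding gp.independent_explicit_finite_subsets
proof (intro allI impI ballI, rule ccontr)
  fix T u v
  assume T: "T \<subseteq> S" "finite T" and sum: "(\<Sum>v\<in>T. gp_scale (u v) v) = 0"
    and "v \<in> T" "u v \<noteq> 0"
  then have nonzero_coeffs: "finite {v\<in>T. u v \<noteq> 0}" "{v\<in>T. u v \<noteq> 0} \<noteq> {}" by auto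
  then obtain w where w_coeff: "w \<in> T" "u w \<noteq> 0"
    and min: "\<And>v. v \<in> T \<Longrightarrow> u v \<noteq> 0 \<Longrightarrow> gp_deg w \<le> gp_deg v"
    using ex_is_arg_min_if_finite[OF nonzero_coeffs, of gp_deg]
    by (auto simp: is_arg_min_linorder)
  have deg: "\<exists>e. gp_deg v = ereal e" if "v \<in> T" for v
    using that T(1) nonzero by (intro gp_deg_finite) auto
  obtain d where deg_w: "gp_deg w = ereal d" using deg[OF w_coeff(1)] by blast
  have low: "u v * gp_coeff v d = 0" if v_ne: "v \<in> T - {w}" for v
  proof (cases "u v = 0")
    case False
    obtain e where deg_v: "gp_deg v = ereal e" using deg[of v] v_ne by blast
    have "gp_deg v \<noteq> gp_deg w" using inj_onD[OF inj, of v w] v_ne w_coeff(1) T(1) by blast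
    then have "d < e" using min[of v] v_ne False deg_w deg_v by simp
    then show ?thesis using deg_v by (simp add: gp_deg_eq_ereal_iff)
  qed simp
  have "0 = gp_coeff (\<Sum>v\<in>T. gp_scale (u v) v) d" using sum by simp
  also have "\<dots> = (\<Sum>v\<in>T. u v * gp_coeff v d)" by (simp add: gp_coeff_sum)
  also have "\<dots> = u w * gp_coeff w d"
    using sum.remove[OF T(2) w_coeff(1), of "\<lambda>v. u v * gp_coeff v d"]
      sum.neutral[of "T - {w}"] low
    by simp
  also have "\<dots> \<noteq> 0" using w_coeff(2) deg_w by (simp add: gp_deg_eq_ereal_iff)
  finally show False by simp
qed

section \<open>Kapranov rank of matrices with generic entries\<close>

definition int_independent :: "'t set \<Rightarrow> ('t \<Rightarrow> real) \<Rightarrow> bool" where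
  "int_independent T g \<longleftrightarrow>
    (\<forall>k :: 't \<Rightarrow> int. (\<Sum>t\<in>T. of_int (k t) * g t) = 0 \<longrightarrow> (\<forall>t\<in>T. k t = 0))"

lemma int_independent_inj_on:
  assumes "int_independent T g"
  shows "inj_on (\<lambda>e. \<Sum>t\<in>T. real (e t) * g t) (T \<rightarrow>\<^sub>E UNIV)"
proof (rule inj_onI)
  fix d e assume PiE: "d \<in> T \<rightarrow>\<^sub>E UNIV" "e \<in> T \<rightarrow>\<^sub>E UNIV"
    and eq: "(\<Sum>t\<in>T. real (d t) * g t) = (\<Sum>t\<in>T. real (e t) * g t)"
  have "(\<Sum>t\<in>T. of_int (int (d t) - int (e t)) * g t) = 0"
    using eq by (simp add: left_diff_distrib sum_subtractf)
  then have "\<forall>t\<in>T. int (d t) - int (e t) = 0"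
    using assms[unfolded int_independent_def, rule_format, of "\<lambda>t. int (d t) - int (e t)"]
    by blast
  then show "d = e" using PiE by (intro PiE_ext) auto
qed

lemma countable_int_combinations:
  assumes "finite T"
  shows "countable (range (\<lambda>k :: 't \<Rightarrow> int. \<Sum>t\<in>T. of_int (k t) * g t :: real))"
  using assms
proof (induction T rule: finite_induct)
  case (insert s T)
  let ?W = "range (\<lambda>k :: 't \<Rightarrow> int. \<Sum>t\<in>T. of_int (k t) * g t)"
  have "range (\<lambda>k :: 't \<Rightarrow> int. \<Sum>t\<in>insert s T. of_int (k t) * g t)
      \<subseteq> (\<lambda>(m, w). of_int m * g s + w) ` ((UNIV :: int set) \<times> ?W)"
    using insert.hyps by auto
  then show ?case by (rule countable_subset) (use insert.IH in auto)
qed simp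

lemma int_independent_insert:
  assumes "finite T" "s \<notin> T" and indep: "int_independent T g"
    and avoids: "\<And>k :: 't \<Rightarrow> int. \<And>m. m \<noteq> 0 \<Longrightarrow> z \<noteq> (\<Sum>t\<in>T. of_int (k t) * g t) / of_int m"
  shows "int_independent (insert s T) (g(s := z))"
  unfolding int_independent_def
proof (intro allI impI)
  fix k :: "'t \<Rightarrow> int"
  assume "(\<Sum>t\<in>insert s T. of_int (k t) * (g(s := z)) t) = 0"
  moreover have "(\<Sum>t\<in>T. of_int (k t) * (g(s := z)) t) = (\<Sum>t\<in>T. of_int (k t) * g t)"
    using assms(2) by (intro sum.cong) auto
  ultimately have sum: "of_int (k s) * z + (\<Sum>t\<in>T. of_int (k t) * g t) = 0"
    using assms(1,2) by simp
  have "k s = 0"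
  proof (rule ccontr)
    assume "k s \<noteq> 0"
    then have "z = (\<Sum>t\<in>T. of_int (k t) * g t) / of_int (- k s)"
      using sum by (simp add: field_simps)
    then show False using avoids[of "- k s" k] \<open>k s \<noteq> 0\<close> by simp
  qed
  then show "\<forall>t\<in>insert s T. k t = 0" using sum indep by (auto simp: int_independent_def)
qed

lemma int_independent_exists:
  fixes a b :: real
  assumes "finite T" "a < b"
  obtains g where "g ` T \<subseteq> {a<..<b}" "int_independent T g"
proof -
  have "\<exists>g. g ` T \<subseteq> {a<..<b} \<and> int_independent T g"
    using assms(1)
  proof (induction T rule: finite_induct)
    case (insert s T)
    then obtain g where indep: "g ` T \<subseteq> {a<..<b}" "int_independent T g" by blast
    let ?W = "range (\<lambda>k :: 'a \<Rightarrow> int. \<Sum>t\<in>T. of_int (k t) * g t)"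
    let ?Q = "\<Union>m :: int. (\<lambda>w. w / of_int m) ` ?W"
    have "countable ?Q"
      using countable_int_combinations[OF insert.hyps(1), of g] by auto
    then have "\<not> {a<..<b} \<subseteq> ?Q"
      using uncountable_open_interval[of a b] assms(2) countable_subset by blast
    then obtain z where z_new: "z \<in> {a<..<b}" "z \<notin> ?Q" by blast
    have "int_independent (insert s T) (g(s := z))"
      using insert.hyps indep(2) by (rule int_independent_insert) (use z_new(2) in blast)
    moreover have "(g(s := z)) ` insert s T \<subseteq> {a<..<b}" using indep(1) z_new(1) by auto
    ultimately show ?case by blast
  qed (simp add: int_independent_def)
  then show thesis using that by blast
qed

lemma algebraically_independent_if_int_independent_degs:
  fixes x :: "'t \<Rightarrow> 'a::field gpuiseux"
  assumes deg: "\<And>t. t \<in> T \<Longrightarrow> gp_deg (x t) = ereal (g t)" and indep: "int_independent T g"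
  shows "gp.algebraically_independent T x"
proof -
  have deg_monomial: "gp_deg (monomial T x e) = ereal (\<Sum>t\<in>T. real (e t) * g t)" for e
    using deg by (rule gp_deg_monomial)
  then have "gp_deg \<circ> monomial T x = ereal \<circ> (\<lambda>e. \<Sum>t\<in>T. real (e t) * g t)"
    by (intro ext) simp
  moreover have "inj_on (ereal \<circ> (\<lambda>e. \<Sum>t\<in>T. real (e t) * g t)) (T \<rightarrow>\<^sub>E UNIV)"
    using int_independent_inj_on[OF indep] by (rule comp_inj_on) (simp add: inj_on_def)
  ultimately have inj: "inj_on (gp_deg \<circ> monomial T x) (T \<rightarrow>\<^sub>E UNIV)" by (simp only:)
  have "monomial T x e \<noteq> 0" for e
    using deg_monomial[of e] by (auto simp: gp_deg_zero)
  then have "gp.independent (monomial T x ` (T \<rightarrow>\<^sub>E UNIV))"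
    using inj_on_imageI[OF inj] by (intro gp_independent_if_inj_on_gp_deg) (metis imageE)
  then show ?thesis
    using inj_on_imageI2[OF inj] by (simp add: gp.algebraically_independent_def)
qed

lemma kapranov_rank_attained:
  assumes "A \<in> tropical_mat m n"
  obtains L :: "'f::field gpuiseux mat" where "L \<in> carrier_mat m n"
    "\<And>i j. i < m \<Longrightarrow> j < n \<Longrightarrow> gp_deg (L $$ (i, j)) = A $$ (i, j)"
    "vec_space.rank m L = kapranov_rank TYPE('f) A"
proof -
  let ?lift = "\<lambda>r. \<exists>L :: 'f gpuiseux mat. L \<in> carrier_mat (dim_row A) (dim_col A) \<and>
    (\<forall>i<dim_row A. \<forall>j<dim_col A. gp_deg (L $$ (i, j)) = A $$ (i, j)) \<and>
    vec_space.rank (dim_row A) L = r"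
  have dim: "dim_row A = m" "dim_col A = n" using assms by (auto simp: tropical_mat_def)
  have "\<exists>r. ?lift r" using kapranov_lift_exists[OF assms] unfolding dim by blast
  then have "?lift (kapranov_rank TYPE('f) A)" unfolding kapranov_rank_def by (rule LeastI_ex)
  then show thesis using that unfolding dim by blast
qed

lemma card_int_independent_entries:
  assumes A: "A \<in> tropical_mat m n" and T: "T \<subseteq> {..<m} \<times> {..<n}"
    and entry: "\<And>t. t \<in> T \<Longrightarrow> A $$ t = ereal (g t)" and indep: "int_independent T g"
  defines "r \<equiv> kapranov_rank TYPE('f::field) A"
  shows "card T + (m - r) * (n - r) \<le> m * n"
proof -
  obtain L :: "'f gpuiseux mat" where L: "L \<in> carrier_mat m n"
    and deg: "\<And>i j. i < m \<Longrightarrow> j < n \<Longrightarrow> gp_deg (L $$ (i, j)) = A $$ (i, j)"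
    and rank: "vec_space.rank m L = r"
    unfolding r_def using kapranov_rank_attained[OF A] by blast
  have "gp_deg (L $$ t) = ereal (g t)" if "t \<in> T" for t
    using deg T entry[OF that] that by (cases t) auto
  then have "gp.algebraically_independent T (\<lambda>t. L $$ t)"
    using indep by (rule algebraically_independent_if_int_independent_degs)
  then show ?thesis
    using gp.card_algebraically_independent_entries[OF L T] unfolding rank by blast
qed

section \<open>Permutations along cycles and closed sets of digraphs\<close>

lemma self_map_permutes_subset:
  assumes "finite Q" "Q \<noteq> {}" "f ` Q \<subseteq> Q"
  obtains R where "R \<subseteq> Q" "R \<noteq> {}" "bij_betw f R R"
proof -
  let ?invariant = "\<lambda>R. R \<subseteq> Q \<and> R \<noteq> {} \<and> f ` R \<subseteq> R"
  have "?invariant Q" using assms by blast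
  then obtain R where R: "?invariant R" and min: "\<And>R'. ?invariant R' \<Longrightarrow> card R \<le> card R'"
    using ex_has_least_nat[of ?invariant Q card] by blast
  have fin: "finite R" using R assms(1) finite_subset by blast
  have "card R \<le> card (f ` R)" using R by (intro min) blast
  then have "f ` R = R" using R card_seteq[OF fin] by blast
  then have "bij_betw f R R" using eq_card_imp_inj_on[OF fin, of f] by (simp add: bij_betw_def)
  then show thesis using that R by blast
qed

lemma permutation_along_cycle:
  assumes fin: "finite E" and irrefl: "irrefl E" and cyclic: "\<not> acyclic E"
  obtains \<pi> where "\<pi> permutes Domain E" "\<pi> \<noteq> id" "\<And>v. \<pi> v \<noteq> v \<Longrightarrow> (v, \<pi> v) \<in> E"
proof -
  have "\<not> wf (E\<inverse>)" using fin cyclic by (simp add: wf_iff_acyclic_if_finite)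
  then obtain Q where successors: "Q \<noteq> {}" "\<forall>v\<in>Q. \<exists>w. (v, w) \<in> E \<and> w \<in> Q"
    unfolding wf_iff_ex_minimal by auto
  then obtain f where f_edge: "\<And>v. v \<in> Q \<Longrightarrow> (v, f v) \<in> E \<and> f v \<in> Q" by metis
  then have "Q \<subseteq> Domain E" by blast
  then have "finite Q" using fin finite_Domain finite_subset by blast
  then obtain R where R: "R \<subseteq> Q" "R \<noteq> {}" "bij_betw f R R"
    using self_map_permutes_subset[of Q f] successors(1) f_edge by blast
  define \<pi> where "\<pi> v = (if v \<in> R then f v else v)" for v
  have "bij_betw \<pi> R R" using R(3) by (rule bij_betw_cong[THEN iffD1, rotated]) (simp add: \<pi>_def)
  then have "\<pi> permutes R" by (rule bij_imp_permutes) (simp add: \<pi>_def)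
  then have "\<pi> permutes Domain E" by (rule permutes_subset) (use R(1) \<open>Q \<subseteq> Domain E\<close> in blast)
  moreover have "(v, \<pi> v) \<in> E" if "\<pi> v \<noteq> v" for v
    using that f_edge R(1) by (auto simp: \<pi>_def split: if_splits)
  moreover have "\<pi> \<noteq> id"
  proof
    assume "\<pi> = id"
    obtain v where "v \<in> R" using R(2) by blast
    then have "(v, \<pi> v) \<in> E" using f_edge R(1) by (auto simp: \<pi>_def)
    then show False using \<open>\<pi> = id\<close> irrefl by (simp add: irrefl_def)
  qed
  ultimately show thesis using that by blast
qed

lemma acyclic_closed_subset_of_card:
  assumes fin: "finite P" "finite E" and acyclic: "acyclic E" and card_ge: "c \<le> card P"
  obtains S where "S \<subseteq> P" "card S = c" "E `` S \<inter> P \<subseteq> S"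
proof -
  have "\<exists>S\<subseteq>P. card S = c \<and> E `` S \<inter> P \<subseteq> S"
    using card_ge
  proof (induction c)
    case (Suc c)
    then obtain S where closed: "S \<subseteq> P" "card S = c" "E `` S \<inter> P \<subseteq> S" by auto
    have "finite S" using closed(1) fin(1) finite_subset by blast
    then have "P - S \<noteq> {}" using Suc.prems closed(2) card_mono[of S P] by auto
    then obtain v where sink: "v \<in> P - S" "\<And>w. (v, w) \<in> E \<Longrightarrow> w \<notin> P - S"
      using finite_acyclic_wf_converse[OF fin(2) acyclic] unfolding wf_iff_ex_minimal
      by (metis converseI)
    then have "E `` insert v S \<inter> P \<subseteq> insert v S" using closed(3) by blast
    moreover have "card (insert v S) = Suc c" using sink(1) closed(2) \<open>finite S\<close> by simp
    ultimately show ?case using closed(1) sink(1) by (intro exI[of _ "insert v S"]) auto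
  qed auto
  then show thesis using that by blast
qed

section \<open>Tropical rank of matrices with a zero pattern\<close>

definition zero_pattern ::
    "'p set \<Rightarrow> 'q set \<Rightarrow> ('p \<times> 'q) set \<Rightarrow> ('p \<Rightarrow> 'q \<Rightarrow> 'a::{ord,zero,numeral}) \<Rightarrow> bool" where
  "zero_pattern U V Z b \<longleftrightarrow>
    (\<forall>p\<in>U. \<forall>q\<in>V. if (p, q) \<in> Z then b p q = 0 else 1 \<le> b p q \<and> b p q \<le> 2)"

definition meets_squares :: "'p set \<Rightarrow> 'q set \<Rightarrow> nat \<Rightarrow> ('p \<times> 'q) set \<Rightarrow> bool" where
  "meets_squares U V c Z \<longleftrightarrow>
    (\<forall>I\<subseteq>U. \<forall>J\<subseteq>V. card I = c \<longrightarrow> card J = c \<longrightarrow> I \<times> J \<inter> Z \<noteq> {})"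

lemma zero_patternD:
  "zero_pattern U V Z b \<Longrightarrow> p \<in> U \<Longrightarrow> q \<in> V \<Longrightarrow>
    if (p, q) \<in> Z then b p q = 0 else 1 \<le> b p q \<and> b p q \<le> 2"
  by (simp add: zero_pattern_def)

lemma zero_pattern_vimage:
  assumes "zero_pattern U V Z b" "f ` U' \<subseteq> U" "g ` V' \<subseteq> V"
  shows "zero_pattern U' V' (map_prod f g -` Z) (\<lambda>p q. b (f p) (g q))"
  using assms unfolding zero_pattern_def by (simp add: image_subset_iff)

lemma zero_pattern_real_of_ereal:
  assumes pattern: "zero_pattern U V Z b"
  shows "zero_pattern U V Z (\<lambda>p q. real_of_ereal (b p q))"
    and "p \<in> U \<Longrightarrow> q \<in> V \<Longrightarrow> b p q = ereal (real_of_ereal (b p q))"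
proof -
  have "b p q = ereal (real_of_ereal (b p q)) \<and> (if (p, q) \<in> Z then real_of_ereal (b p q) = 0
      else 1 \<le> real_of_ereal (b p q) \<and> real_of_ereal (b p q) \<le> 2)" if "p \<in> U" "q \<in> V" for p q
    using zero_patternD[OF pattern that] by (cases "b p q") (auto split: if_splits)
  then show "zero_pattern U V Z (\<lambda>p q. real_of_ereal (b p q))"
    and "p \<in> U \<Longrightarrow> q \<in> V \<Longrightarrow> b p q = ereal (real_of_ereal (b p q))"
    unfolding zero_pattern_def by blast+
qed

lemma meets_squares_vimage:
  assumes meets: "meets_squares U V c Z"
    and f_maps: "f ` U' \<subseteq> U" "inj_on f U'" and g_maps: "g ` V' \<subseteq> V" "inj_on g V'"
  shows "meets_squares U' V' c (map_prod f g -` Z)"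
  unfolding meets_squares_def
proof (intro allI impI)
  fix I J assume IJ: "I \<subseteq> U'" "J \<subseteq> V'" "card I = c" "card J = c"
  have "card (f ` I) = c" "card (g ` J) = c"
    using IJ f_maps(2) g_maps(2) by (simp_all add: card_image inj_on_subset)
  moreover have "f ` I \<subseteq> U" "g ` J \<subseteq> V" using IJ f_maps(1) g_maps(1) by blast+
  ultimately have "f ` I \<times> g ` J \<inter> Z \<noteq> {}" using meets unfolding meets_squares_def by blast
  then show "I \<times> J \<inter> map_prod f g -` Z \<noteq> {}" by auto
qed

definition unique_optimal_id :: "'v set \<Rightarrow> ('v \<Rightarrow> 'v \<Rightarrow> real) \<Rightarrow> bool" where
  "unique_optimal_id V b \<longleftrightarrow>
    (\<forall>\<pi>. \<pi> permutes V \<longrightarrow> \<pi> \<noteq> id \<longrightarrow> (\<Sum>p\<in>V. b p p) < (\<Sum>p\<in>V. b p (\<pi> p)))"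

text \<open>A transposition through a zero replaces two entries that sum to at least 2 by \<open>0\<close> and an
  entry that is at most 2.\<close>

lemma card_nonzero_diagonal_less:
  fixes b :: "'v \<Rightarrow> 'v \<Rightarrow> real"
  assumes fin: "finite V" and pattern: "zero_pattern V V Z b" and opt: "unique_optimal_id V b"
    and meets: "meets_squares V V c Z"
  shows "card {p \<in> V. (p, p) \<notin> Z} < c"
proof (rule ccontr)
  assume "\<not> card {p \<in> V. (p, p) \<notin> Z} < c"
  then obtain R where R: "R \<subseteq> {p \<in> V. (p, p) \<notin> Z}" "card R = c"
    by (meson not_less obtain_subset_with_card_n)
  then have "R \<times> R \<inter> Z \<noteq> {}" using meets unfolding meets_squares_def by blast
  then obtain p q where pq: "p \<in> V" "q \<in> V" "(p, q) \<in> Z" "(p, p) \<notin> Z" "(q, q) \<notin> Z"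
    using R(1) by blast
  then have distinct: "p \<noteq> q" by blast
  have split: "sum h V = h p + (h q + sum h (V - {p} - {q}))" for h :: "'v \<Rightarrow> real"
    using fin pq(1,2) distinct by (simp add: sum.remove[of V p] sum.remove[of "V - {p}" q])
  define \<tau> where "\<tau> = transpose p q"
  have \<tau>: "\<tau> p = q" "\<tau> q = p" "\<And>i. i \<notin> {p, q} \<Longrightarrow> \<tau> i = i"
    by (auto simp: \<tau>_def transpose_def)
  have "\<tau> permutes V" unfolding \<tau>_def using pq(1,2) by (rule permutes_swap_id)
  moreover have "\<tau> \<noteq> id" using \<tau>(1) distinct by auto
  ultimately have "(\<Sum>i\<in>V. b i i) < (\<Sum>i\<in>V. b i (\<tau> i))"
    using opt by (simp add: unique_optimal_id_def)
  moreover have "(\<Sum>i\<in>V - {p} - {q}. b i (\<tau> i)) = (\<Sum>i\<in>V - {p} - {q}. b i i)"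
    using \<tau>(3) by (intro sum.cong) auto
  moreover have "b p q = 0" "b q p \<le> 2" "1 \<le> b p p" "1 \<le> b q q"
    using pq zero_patternD[OF pattern, of p q] zero_patternD[OF pattern, of q p]
      zero_patternD[OF pattern, of p p] zero_patternD[OF pattern, of q q]
    by (auto split: if_splits)
  ultimately show False unfolding split \<tau>(1,2) by linarith
qed

text \<open>A cyclic permutation along zeros leaves the weight of a zero diagonal unchanged.\<close>

lemma acyclic_zeros_on_zero_diagonal:
  fixes b :: "'v \<Rightarrow> 'v \<Rightarrow> real"
  assumes fin: "finite V" and pattern: "zero_pattern V V Z b" and opt: "unique_optimal_id V b"
    and P: "P \<subseteq> V" "\<And>p. p \<in> P \<Longrightarrow> (p, p) \<in> Z"
  shows "acyclic (Z \<inter> P \<times> P - Id)"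
proof (rule ccontr)
  let ?E = "Z \<inter> P \<times> P - Id"
  assume "\<not> acyclic ?E"
  moreover have "finite ?E" using finite_subset[OF P(1) fin] by blast
  moreover have "irrefl ?E" by (simp add: irrefl_def)
  ultimately obtain \<pi> where \<pi>: "\<pi> permutes Domain ?E" "\<pi> \<noteq> id"
    and edge: "\<And>v. \<pi> v \<noteq> v \<Longrightarrow> (v, \<pi> v) \<in> ?E"
    using permutation_along_cycle by blast
  have "b p (\<pi> p) = b p p" for p
  proof (cases "\<pi> p = p")
    case False
    then have "p \<in> P" "\<pi> p \<in> P" "(p, \<pi> p) \<in> Z" using edge by auto
    then show ?thesis using pattern P unfolding zero_pattern_def by (metis subsetD)
  qed simp
  moreover have "\<pi> permutes V" using \<pi>(1) by (rule permutes_subset) (use P(1) in blast)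
  ultimately show False using opt \<pi>(2) by (auto simp: unique_optimal_id_def)
qed

text \<open>For a successor-closed set \<open>S\<close> of the acyclic digraph of zeros on \<open>P\<close>, the rectangle
  \<open>S \<times> (P - S)\<close> misses \<open>Z\<close>.\<close>

lemma card_less_if_unique_optimal_id:
  fixes b :: "'v \<Rightarrow> 'v \<Rightarrow> real"
  assumes fin: "finite V" and pattern: "zero_pattern V V Z b" and opt: "unique_optimal_id V b"
    and meets: "meets_squares V V c Z"
  shows "card V < 3 * c"
proof (rule ccontr)
  assume large: "\<not> card V < 3 * c"
  define P where "P = {p \<in> V. (p, p) \<in> Z}"
  let ?E = "Z \<inter> P \<times> P - Id"
  have P: "finite P" "P \<subseteq> V" using fin by (auto simp: P_def)
  have "V - P = {p \<in> V. (p, p) \<notin> Z}" by (auto simp: P_def)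
  then have "card (V - P) < c" using card_nonzero_diagonal_less[OF fin pattern opt meets] by simp
  then have "2 * c \<le> card P" using large card_Diff_subset[OF P] by linarith
  have "acyclic ?E"
    using fin pattern opt P(2) by (rule acyclic_zeros_on_zero_diagonal) (simp add: P_def)
  moreover have "finite ?E" using P(1) by blast
  moreover have "c \<le> card P" using \<open>2 * c \<le> card P\<close> by simp
  ultimately obtain S where S: "S \<subseteq> P" "card S = c" "?E `` S \<inter> P \<subseteq> S"
    using acyclic_closed_subset_of_card[OF P(1)] by blast
  have "c \<le> card (P - S)"
    using S(1,2) \<open>2 * c \<le> card P\<close> P(1) by (simp add: card_Diff_subset finite_subset)
  then obtain S' where S': "S' \<subseteq> P - S" "card S' = c" by (meson obtain_subset_with_card_n)
  have "S \<times> S' \<inter> Z = {}" using S(1,3) S'(1) by blast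
  moreover have "S \<subseteq> V" "S' \<subseteq> V" using S(1) S'(1) P(2) by blast+
  ultimately show False using meets S(2) S'(2) unfolding meets_squares_def by blast
qed

lemma tropically_nonsingular_unique_optimum:
  assumes "tropically_nonsingular B"
  obtains \<sigma> where "\<sigma> permutes {..<dim_row B}"
    "\<And>\<tau>. \<tau> permutes {..<dim_row B} \<Longrightarrow> \<tau> \<noteq> \<sigma> \<Longrightarrow> perm_weight B \<sigma> < perm_weight B \<tau>"
proof -
  obtain \<sigma> where \<sigma>: "\<sigma> permutes {..<dim_row B}" "perm_weight B \<sigma> = tropical_det B"
    and unique: "\<And>\<tau>. \<tau> permutes {..<dim_row B} \<Longrightarrow> perm_weight B \<tau> = tropical_det B \<Longrightarrow> \<tau> = \<sigma>"
    using assms unfolding tropically_nonsingular_def by blast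
  have "perm_weight B \<sigma> < perm_weight B \<tau>"
    if \<tau>: "\<tau> permutes {..<dim_row B}" "\<tau> \<noteq> \<sigma>" for \<tau>
  proof -
    have "tropical_det B \<le> perm_weight B \<tau>"
      unfolding tropical_det_def using \<tau>(1)
      by (intro Min_le finite_imageI finite_permutations imageI) auto
    then show ?thesis using \<sigma>(2) unique[OF \<tau>(1)] \<tau>(2) by (metis order_le_less)
  qed
  then show thesis using that \<sigma>(1) by blast
qed

lemma dim_less_if_tropically_nonsingular:
  assumes nonsing: "tropically_nonsingular B"
    and pattern: "zero_pattern {..<dim_row B} {..<dim_row B} Z (\<lambda>i j. B $$ (i, j))"
    and meets: "meets_squares {..<dim_row B} {..<dim_row B} c Z"
  shows "dim_row B < 3 * c"
proof -
  let ?V = "{..<dim_row B}"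
  obtain \<sigma> where \<sigma>: "\<sigma> permutes ?V"
    and opt: "\<And>\<tau>. \<tau> permutes ?V \<Longrightarrow> \<tau> \<noteq> \<sigma> \<Longrightarrow> perm_weight B \<sigma> < perm_weight B \<tau>"
    using tropically_nonsingular_unique_optimum[OF nonsing] by blast
  have \<sigma>V: "\<sigma> ` ?V \<subseteq> ?V" "inj_on \<sigma> ?V"
    using permutes_image[OF \<sigma>] permutes_inj_on[OF \<sigma>] by auto
  define Z' where "Z' = map_prod id \<sigma> -` Z"
  define b where "b p q = real_of_ereal (B $$ (p, \<sigma> q))" for p q
  have "zero_pattern ?V ?V Z' (\<lambda>p q. B $$ (p, \<sigma> q))"
    using zero_pattern_vimage[OF pattern _ \<sigma>V(1), of id] by (simp add: Z'_def)
  from zero_pattern_real_of_ereal[OF this]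
  have pattern_b: "zero_pattern ?V ?V Z' b"
    and entry: "\<And>p q. p \<in> ?V \<Longrightarrow> q \<in> ?V \<Longrightarrow> B $$ (p, \<sigma> q) = ereal (b p q)"
    unfolding b_def by blast+
  have weight: "perm_weight B (\<sigma> \<circ> \<pi>) = ereal (\<Sum>p\<in>?V. b p (\<pi> p))" if "\<pi> permutes ?V" for \<pi>
    using entry permutes_in_image[OF that] by (simp add: perm_weight_def flip: sum_ereal)
  have "card ?V < 3 * c"
  proof (rule card_less_if_unique_optimal_id[OF _ pattern_b])
    show "meets_squares ?V ?V c Z'"
      unfolding Z'_def using meets \<sigma>V by (intro meets_squares_vimage) auto
    show "unique_optimal_id ?V b"
      unfolding unique_optimal_id_def
    proof (intro allI impI)
      fix \<pi> assume \<pi>: "\<pi> permutes ?V" "\<pi> \<noteq> id"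
      have "\<sigma> \<circ> \<pi> \<noteq> \<sigma>"
        using \<pi>(2) permutes_inj[OF \<sigma>] by (auto simp: fun_eq_iff inj_eq)
      then have "perm_weight B (\<sigma> \<circ> id) < perm_weight B (\<sigma> \<circ> \<pi>)"
        using opt[of "\<sigma> \<circ> \<pi>"] permutes_compose[OF \<pi>(1) \<sigma>] by simp
      then show "(\<Sum>p\<in>?V. b p p) < (\<Sum>p\<in>?V. b p (\<pi> p))"
        using weight[OF \<pi>(1)] weight[OF permutes_id] by simp
    qed
  qed simp
  then show ?thesis by simp
qed

lemma submatrix_dim_index:
  assumes rows: "I \<subseteq> {..<dim_row A}" and cols: "J \<subseteq> {..<dim_col A}"
  shows "dim_row (submatrix A I J) = card I"
    and "i < card I \<Longrightarrow> j < card J \<Longrightarrow> submatrix A I J $$ (i, j) = A $$ (pick I i, pick J j)"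
proof -
  have "{i. i < dim_row A \<and> i \<in> I} = I" "{j. j < dim_col A \<and> j \<in> J} = J" using rows cols by auto
  then show "dim_row (submatrix A I J) = card I"
    and "i < card I \<Longrightarrow> j < card J \<Longrightarrow> submatrix A I J $$ (i, j) = A $$ (pick I i, pick J j)"
    using dim_submatrix(1)[of A I J] submatrix_index[of i A I j J] by simp_all
qed

lemma inj_on_pick: "inj_on (pick I) {..<card I}"
  by (rule inj_onI) (metis card_pick_le lessThan_iff)

lemma pick_image_subset: "pick I ` {..<card I} \<subseteq> I"
  using pick_in_set_le by auto

lemma tropical_rank_attained:
  obtains I J where "I \<subseteq> {..<dim_row A}" "J \<subseteq> {..<dim_col A}"
    "card I = tropical_rank A" "card J = tropical_rank A" "tropically_nonsingular (submatrix A I J)"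
proof -
  let ?M = "{m. \<exists>I J. I \<subseteq> {..<dim_row A} \<and> J \<subseteq> {..<dim_col A} \<and>
    card I = m \<and> card J = m \<and> tropically_nonsingular (submatrix A I J)}"
  have "0 \<in> ?M" using tropically_nonsingular_empty[of A] by (auto intro!: exI[of _ "{}"])
  then have "tropical_rank A \<in> ?M"
    unfolding tropical_rank_def by (intro Max_in tropical_rank_finite) blast
  then show thesis using that by blast
qed

lemma tropical_rank_less:
  assumes A: "A \<in> carrier_mat m n"
    and pattern: "zero_pattern {..<m} {..<n} Z (\<lambda>i j. A $$ (i, j))"
    and meets: "meets_squares {..<m} {..<n} c Z"
  shows "tropical_rank A < 3 * c"
proof -
  define k where "k = tropical_rank A"
  obtain I J where IJ: "I \<subseteq> {..<m}" "J \<subseteq> {..<n}" and card: "card I = k" "card J = k"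
    and nonsing: "tropically_nonsingular (submatrix A I J)"
    unfolding k_def using tropical_rank_attained[of A] A by auto
  let ?B = "submatrix A I J" and ?Z = "map_prod (pick I) (pick J) -` Z"
  have dim: "dim_row ?B = k"
    and entry: "\<And>i j. i < k \<Longrightarrow> j < k \<Longrightarrow> ?B $$ (i, j) = A $$ (pick I i, pick J j)"
    using submatrix_dim_index[of I A J] A IJ card by simp_all
  have pick: "pick I ` {..<k} \<subseteq> {..<m}" "pick J ` {..<k} \<subseteq> {..<n}"
    "inj_on (pick I) {..<k}" "inj_on (pick J) {..<k}"
    using pick_image_subset[of I] pick_image_subset[of J] inj_on_pick[of I] inj_on_pick[of J] IJ
    unfolding card by blast+
  have "zero_pattern {..<k} {..<k} ?Z (\<lambda>i j. ?B $$ (i, j))"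
    using zero_pattern_vimage[OF pattern pick(1,2)]
    by (simp add: zero_pattern_def entry cong: if_cong)
  moreover have "meets_squares {..<k} {..<k} c ?Z"
    using meets_squares_vimage[OF meets pick(1,3) pick(2,4)] .
  ultimately show ?thesis
    using dim_less_if_tropically_nonsingular[OF nonsing] unfolding dim k_def by blast
qed

section \<open>Sparse sets meeting all squares\<close>

lemma frequent_element_exists:
  fixes F :: "'a set set"
  assumes fin: "finite U" "U \<noteq> {}" "finite F"
    and sub: "\<And>X. X \<in> F \<Longrightarrow> X \<subseteq> U" and large: "\<And>X. X \<in> F \<Longrightarrow> d \<le> card X"
  obtains u where "u \<in> U" "d * card F \<le> card U * card {X \<in> F. u \<in> X}"
proof -
  have "d * card F \<le> (\<Sum>X\<in>F. card X)"
    using sum_mono[of F "\<lambda>X. d" card] large by (simp add: mult.commute)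
  also have "\<dots> = (\<Sum>u\<in>U. card {X \<in> F. u \<in> X})"
  proof (rule sum_multicount_gen[symmetric])
    show "\<forall>X\<in>F. card {u \<in> U. u \<in> X} = card X"
    proof
      fix X assume "X \<in> F"
      then have "{u \<in> U. u \<in> X} = X" using sub by blast
      then show "card {u \<in> U. u \<in> X} = card X" by simp
    qed
  qed (use fin in auto)
  finally have double_count: "d * card F \<le> (\<Sum>u\<in>U. card {X \<in> F. u \<in> X})" .
  have "\<exists>u\<in>U. d * card F \<le> card U * card {X \<in> F. u \<in> X}"
  proof (rule ccontr)
    assume "\<not> ?thesis"
    then have "(\<Sum>u\<in>U. card U * card {X \<in> F. u \<in> X}) < (\<Sum>u\<in>U. d * card F)"
      using fin(1,2) by (intro sum_strict_mono) (auto simp: not_le)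
    also have "\<dots> \<le> card U * (\<Sum>u\<in>U. card {X \<in> F. u \<in> X})" using double_count by simp
    finally show False by (simp add: sum_distrib_left)
  qed
  then show thesis using that by blast
qed

lemma element_missing_few_exists:
  fixes F :: "'a set set"
  assumes fin: "finite U" "U \<noteq> {}" "finite F"
    and sub: "\<And>X. X \<in> F \<Longrightarrow> X \<subseteq> U" and large: "\<And>X. X \<in> F \<Longrightarrow> d \<le> card X"
  obtains u where "u \<in> U"
    "real (card {X \<in> F. u \<notin> X}) \<le> real (card F) * exp (- (real d / real (card U)))"
proof -
  obtain u where "u \<in> U" and "d * card F \<le> card U * card {X \<in> F. u \<in> X}"
    using frequent_element_exists[OF fin sub large] by blast
  then have "real d * real (card F) \<le> real (card U) * real (card {X \<in> F. u \<in> X})"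
    by (metis of_nat_le_iff of_nat_mult)
  then have hit: "real d / real (card U) * real (card F) \<le> real (card {X \<in> F. u \<in> X})"
    using fin(1,2) by (simp add: field_simps card_gt_0_iff)
  have "{X \<in> F. u \<notin> X} = F - {X \<in> F. u \<in> X}" by auto
  then have "real (card {X \<in> F. u \<notin> X}) = real (card F) - real (card {X \<in> F. u \<in> X})"
    using fin(3) card_mono[OF fin(3), of "{X \<in> F. u \<in> X}"]
    by (simp add: card_Diff_subset of_nat_diff)
  also have "\<dots> \<le> real (card F) * (1 + - (real d / real (card U)))"
    using hit by (simp add: algebra_simps)
  also have "\<dots> \<le> real (card F) * exp (- (real d / real (card U)))"
    using exp_ge_add_one_self by (rule mult_left_mono) simp
  finally show thesis using that \<open>u \<in> U\<close> by blast
qed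

lemma greedy_partial_hitting_set:
  fixes F :: "'a set set"
  assumes fin: "finite U" "finite F"
    and sub: "\<And>X. X \<in> F \<Longrightarrow> X \<subseteq> U" and large: "\<And>X. X \<in> F \<Longrightarrow> d \<le> card X"
  defines "\<delta> \<equiv> real d / real (card U)"
  shows "\<exists>H\<subseteq>U. card H \<le> s \<and>
    real (card {X \<in> F. X \<inter> H = {}}) \<le> real (card F) * exp (- \<delta> * real s)"
proof (induction s)
  case (Suc s)
  then obtain H where H: "H \<subseteq> U" "card H \<le> s"
    and missed: "real (card {X \<in> F. X \<inter> H = {}}) \<le> real (card F) * exp (- \<delta> * real s)"
    by blast
  show ?case
  proof (cases "U = {}")
    case True
    then show ?thesis
      using card_mono[OF fin(2), of "{X \<in> F. X \<inter> {} = {}}"] by (auto simp: \<delta>_def)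
  next
    case False
    define G where "G = {X \<in> F. X \<inter> H = {}}"
    have "finite G" using fin(2) by (simp add: G_def)
    then obtain u where "u \<in> U" and "real (card {X \<in> G. u \<notin> X}) \<le> real (card G) * exp (- \<delta>)"
      using element_missing_few_exists[of U G d] fin(1) False sub large
      unfolding G_def \<delta>_def by blast
    moreover have "{X \<in> F. X \<inter> insert u H = {}} = {X \<in> G. u \<notin> X}" by (auto simp: G_def)
    ultimately have "real (card {X \<in> F. X \<inter> insert u H = {}}) \<le> real (card G) * exp (- \<delta>)"
      by simp
    also have "\<dots> \<le> real (card F) * exp (- \<delta> * real s) * exp (- \<delta>)"
      using missed unfolding G_def by (rule mult_right_mono) simp
    also have "\<dots> = real (card F) * exp (- \<delta> * real (Suc s))"
      by (simp add: algebra_simps flip: exp_add)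
    finally have "real (card {X \<in> F. X \<inter> insert u H = {}})
        \<le> real (card F) * exp (- \<delta> * real (Suc s))" .
    moreover have "card (insert u H) \<le> Suc s" using card_insert_le_m1[of "Suc s" H u] H(2) by simp
    ultimately show ?thesis using \<open>u \<in> U\<close> H(1) by (intro exI[of _ "insert u H"]) auto
  qed
qed auto

lemma hitting_set_exists:
  fixes F :: "'a set set"
  assumes fin: "finite U" "finite F"
    and sub: "\<And>X. X \<in> F \<Longrightarrow> X \<subseteq> U" and large: "\<And>X. X \<in> F \<Longrightarrow> d \<le> card X"
    and few: "real (card F) < exp (real d / real (card U) * real s)"
  obtains H where "H \<subseteq> U" "card H \<le> s" "\<And>X. X \<in> F \<Longrightarrow> X \<inter> H \<noteq> {}"
proof -
  let ?\<delta> = "real d / real (card U)"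
  obtain H where H: "H \<subseteq> U" "card H \<le> s"
    and missed: "real (card {X \<in> F. X \<inter> H = {}}) \<le> real (card F) * exp (- ?\<delta> * real s)"
    using greedy_partial_hitting_set[OF fin sub large] by blast
  note missed
  also have "real (card F) * exp (- ?\<delta> * real s) < 1"
    using few by (simp add: exp_minus field_simps)
  finally have "{X \<in> F. X \<inter> H = {}} = {}" using fin(2) by simp
  then show thesis using that H by blast
qed

lemma card_subsets_le_power:
  assumes "finite A"
  shows "card {B. B \<subseteq> A \<and> card B = k} \<le> card A ^ k"
  using n_subsets[OF assms, of k] binomial_le_pow[of k "card A"]
  by (cases "k \<le> card A") (simp_all add: binomial_eq_0)

definition squares :: "'p set \<Rightarrow> 'q set \<Rightarrow> nat \<Rightarrow> ('p \<times> 'q) set set" where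
  "squares U V c = (\<lambda>(I, J). I \<times> J) ` ({I. I \<subseteq> U \<and> card I = c} \<times> {J. J \<subseteq> V \<and> card J = c})"

lemma meets_squares_iff: "meets_squares U V c Z \<longleftrightarrow> (\<forall>X\<in>squares U V c. X \<inter> Z \<noteq> {})"
  by (auto simp: meets_squares_def squares_def)

lemma squares_subset_card:
  assumes "X \<in> squares U V c"
  shows "X \<subseteq> U \<times> V" "card X = c * c"
  using assms by (auto simp: squares_def card_cartesian_product)

lemma finite_squares: "finite U \<Longrightarrow> finite V \<Longrightarrow> finite (squares U V c)"
  by (simp add: squares_def)

lemma card_squares_le:
  assumes "finite U" "finite V"
  shows "card (squares U V c) \<le> card U ^ c * card V ^ c"
proof -
  have "card (squares U V c) \<le> card {I. I \<subseteq> U \<and> card I = c} * card {J. J \<subseteq> V \<and> card J = c}"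
    unfolding squares_def card_cartesian_product[symmetric]
    using assms by (intro card_image_le) simp
  also have "\<dots> \<le> card U ^ c * card V ^ c"
    using assms by (intro mult_le_mono card_subsets_le_power)
  finally show ?thesis .
qed

lemma sparse_set_meeting_squares:
  assumes fin: "finite U" "finite V" and ne: "U \<noteq> {}" "V \<noteq> {}"
    and size: "(ln (card U) + ln (card V)) * (real (card U) * real (card V)) < real c * real s"
  obtains Z where "Z \<subseteq> U \<times> V" "card Z \<le> s" "meets_squares U V c Z"
proof -
  have pos: "0 < card U" "0 < card V" using fin ne by (simp_all add: card_gt_0_iff)
  then have "0 \<le> (ln (card U) + ln (card V)) * (real (card U) * real (card V))"
    by (intro mult_nonneg_nonneg add_nonneg_nonneg) simp_all
  then have "0 < c" using size by (cases "c = 0") simp_all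
  have "real (card (squares U V c)) \<le> real (card U) ^ c * real (card V) ^ c"
    using card_squares_le[OF fin, of c] by (metis of_nat_le_iff of_nat_mult of_nat_power)
  also have "\<dots> = exp (real c * (ln (card U) + ln (card V)))"
    using pos by (simp add: distrib_left exp_add exp_of_nat_mult)
  also have "\<dots> < exp (real (c * c) / real (card (U \<times> V)) * real s)"
  proof -
    have "real c * (ln (card U) + ln (card V)) * (real (card U) * real (card V))
        < real c * (real c * real s)"
      using size \<open>0 < c\<close> by (simp add: mult.assoc)
    then show ?thesis using pos by (simp add: card_cartesian_product field_simps)
  qed
  finally have few: "real (card (squares U V c))
      < exp (real (c * c) / real (card (U \<times> V)) * real s)" .
  have "X \<subseteq> U \<times> V" "c * c \<le> card X" if "X \<in> squares U V c" for X
    using squares_subset_card[OF that] by simp_all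
  then obtain Z where Z: "Z \<subseteq> U \<times> V" "card Z \<le> s"
    and hit: "\<And>X. X \<in> squares U V c \<Longrightarrow> X \<inter> Z \<noteq> {}"
    using hitting_set_exists[OF finite_cartesian_product[OF fin] finite_squares[OF fin] _ _ few]
    by blast
  have "meets_squares U V c Z" unfolding meets_squares_iff using hit by blast
  then show thesis using that[OF Z] by blast
qed

lemma meets_squares_if_card_less:
  assumes "finite U" "card U < c"
  shows "meets_squares U V c Z"
  unfolding meets_squares_def using assms card_mono[OF assms(1)] by (meson leD)

lemma half_le_ln:
  assumes "2 \<le> (x :: real)"
  shows "1 / 2 \<le> ln x"
proof -
  have "1 - 1 / x \<le> ln x" using ln_le_minus_one[of "1 / x"] assms by (simp add: ln_div)
  moreover have "1 / x \<le> 1 / 2" using assms by (simp add: field_simps)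
  ultimately show ?thesis by linarith
qed

lemma quadratically_sparse_set_meeting_squares:
  fixes n :: nat and \<alpha> :: real
  assumes n_ge: "2 \<le> n" and \<alpha>: "0 < \<alpha>"
  obtains Z c where "Z \<subseteq> {..<n} \<times> {..<n}" "real (card Z) \<le> (\<alpha> * real n)\<^sup>2"
    "real c \<le> 4 * ln (real n) / \<alpha>\<^sup>2 + 1" "meets_squares {..<n} {..<n} c Z"
proof -
  define x where "x = 4 * ln (real n) / \<alpha>\<^sup>2"
  define c where "c = nat \<lfloor>x\<rfloor> + 1"
  have ln_ge: "1 / 2 \<le> ln (real n)" using n_ge by (intro half_le_ln) simp
  then have "0 \<le> x" by (simp add: x_def)
  then have side: "x < real c" "real c \<le> x + 1" unfolding c_def by linarith+
  show thesis
  proof (cases "\<alpha> * real n < 1")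
    case True
    then have "(\<alpha> * real n)\<^sup>2 < 1" using \<alpha> by (simp add: power_less_one_iff)
    then have "\<alpha>\<^sup>2 * (real n * real n) < 4 * ln (real n)"
      using ln_ge by (simp add: power2_eq_square algebra_simps)
    then have "real n * real n < x" using \<alpha> by (simp add: x_def field_simps)
    moreover have "real n \<le> real n * real n" using n_ge by simp
    ultimately have "n < c" using side(1) by linarith
    then have "meets_squares {..<n} {..<n} c {}" by (intro meets_squares_if_card_less) simp_all
    then show thesis using that[of "{}" c] side(2) by (simp add: x_def)
  next
    case False
    define y where "y = (\<alpha> * real n)\<^sup>2"
    define s where "s = nat \<lfloor>y\<rfloor>"
    have "1 \<le> \<lfloor>y\<rfloor>" using False by (simp add: y_def one_le_power)
    then have size: "y / 2 < real s" "real s \<le> y" unfolding s_def by linarith+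
    have "{..<n} \<noteq> {}" using n_ge by (simp add: lessThan_empty_iff)
    have "(ln (real n) + ln (real n)) * (real n * real n) = x * (y / 2)"
      using \<alpha> by (simp add: x_def y_def power2_eq_square)
    also have "\<dots> < real c * real s"
      using side(1) size(1) \<open>0 \<le> x\<close> by (intro mult_strict_mono) (auto simp: y_def)
    finally obtain Z where "Z \<subseteq> {..<n} \<times> {..<n}" "card Z \<le> s" "meets_squares {..<n} {..<n} c Z"
      using sparse_set_meeting_squares[of "{..<n}" "{..<n}" c s] \<open>{..<n} \<noteq> {}\<close> by auto
    then show thesis using that[of Z c] side(2) size(2) by (simp add: x_def y_def)
  qed
qed

section \<open>Tropical rank versus Kapranov rank\<close>

lemma generic_tropical_mat_exists:
  assumes Z: "Z \<subseteq> {..<m} \<times> {..<n}"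
  obtains A where "A \<in> tropical_mat m n" "zero_pattern {..<m} {..<n} Z (\<lambda>i j. A $$ (i, j))"
    "(m - kapranov_rank TYPE('f::field) A) * (n - kapranov_rank TYPE('f) A) \<le> card Z"
proof -
  define T where "T = {..<m} \<times> {..<n} - Z"
  have "finite T" by (simp add: T_def)
  then obtain g :: "nat \<times> nat \<Rightarrow> real" where g: "g ` T \<subseteq> {1<..<2}" "int_independent T g"
    using int_independent_exists[of T 1 2] by auto
  define A where "A = mat m n (\<lambda>t. if t \<in> Z then 0 else ereal (g t))"
  have A: "A \<in> tropical_mat m n" by (auto simp: A_def tropical_mat_def)
  have "1 \<le> g (i, j) \<and> g (i, j) \<le> 2" if "i < m" "j < n" "(i, j) \<notin> Z" for i j
    using g(1) that by (force simp: T_def)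
  then have "zero_pattern {..<m} {..<n} Z (\<lambda>i j. A $$ (i, j))"
    by (simp add: zero_pattern_def A_def)
  moreover have "card T + (m - kapranov_rank TYPE('f) A) * (n - kapranov_rank TYPE('f) A) \<le> m * n"
    using A _ _ g(2) by (rule card_int_independent_entries) (auto simp: T_def A_def)
  moreover have "card T + card Z = m * n"
    using Z card_mono[OF _ Z] finite_subset[OF Z] by (simp add: T_def card_Diff_subset)
  ultimately show thesis using that[OF A] by linarith
qed

lemma three_times_side_le:
  fixes c n :: nat and \<alpha> :: real
  assumes n: "15 \<le> n" and \<alpha>: "0 < \<alpha>" "\<alpha> \<le> 1" and side: "real c \<le> 4 * ln (real n) / \<alpha>\<^sup>2 + 1"
  shows "real (3 * c) \<le> 4 * sqrt (real n) * ln (real n) / \<alpha>\<^sup>2"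
proof -
  have "1 \<le> ln (real n)" using n exp_le by (subst ln_ge_iff) auto
  moreover have "\<alpha>\<^sup>2 \<le> 1" using \<alpha> by (intro power_le_one) auto
  ultimately have ratio: "1 \<le> ln (real n) / \<alpha>\<^sup>2" using \<alpha>(1) by (simp add: field_simps)
  then have "real (3 * c) \<le> 15 * (ln (real n) / \<alpha>\<^sup>2)" using side by simp
  also have "\<dots> \<le> 4 * sqrt (real n) * (ln (real n) / \<alpha>\<^sup>2)"
  proof (rule mult_right_mono)
    have "15 / 4 \<le> sqrt (real n)" using n by (intro real_le_rsqrt) (simp add: power2_eq_square)
    then show "15 \<le> 4 * sqrt (real n)" by simp
  qed (use ratio in linarith)
  finally show ?thesis by simp
qed

theorem theorem2:
  fixes n :: nat and \<alpha> :: real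
  assumes "n > 1000" and "0 < \<alpha>" and "\<alpha> < 0.1"
  shows "\<exists>A \<in> tropical_mat n n.
    real (tropical_rank A) \<le> 4 * sqrt (real n) * ln (real n) / \<alpha>\<^sup>2 \<and>
    real (kapranov_rank TYPE('f::field) A) \<ge> real n * (1 - \<alpha>)"
proof -
  obtain Z c where Z: "Z \<subseteq> {..<n} \<times> {..<n}" "real (card Z) \<le> (\<alpha> * real n)\<^sup>2"
    and side: "real c \<le> 4 * ln (real n) / \<alpha>\<^sup>2 + 1" and meets: "meets_squares {..<n} {..<n} c Z"
    using quadratically_sparse_set_meeting_squares[of n \<alpha>] assms by auto
  obtain A where A: "A \<in> tropical_mat n n" "zero_pattern {..<n} {..<n} Z (\<lambda>i j. A $$ (i, j))"
    and kapranov: "(n - kapranov_rank TYPE('f) A) * (n - kapranov_rank TYPE('f) A) \<le> card Z"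
    using generic_tropical_mat_exists[OF Z(1)] by metis
  have "tropical_rank A < 3 * c"
    using A meets by (intro tropical_rank_less) (simp_all add: tropical_mat_def)
  then have "real (tropical_rank A) \<le> 4 * sqrt (real n) * ln (real n) / \<alpha>\<^sup>2"
    using three_times_side_le[OF _ _ _ side] assms by simp
  moreover have "(real (n - kapranov_rank TYPE('f) A))\<^sup>2 \<le> (\<alpha> * real n)\<^sup>2"
    using kapranov Z(2) by (simp add: power2_eq_square flip: of_nat_mult)
  then have "real (n - kapranov_rank TYPE('f) A) \<le> \<alpha> * real n"
    by (rule power2_le_imp_le) (use assms(2) in simp)
  then have "real n * (1 - \<alpha>) \<le> real (kapranov_rank TYPE('f) A)" by (simp add: algebra_simps)
  ultimately show ?thesis using A(1) by blast
qed

end
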